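(* In the finite-dimensional setting described in the context, let $\beta\in\mathbb{R}$. The entropy is non-negative, i.e. for all past sets $\tilde\Omega\in\mathfrak{P}(\tilde M)$, $$\mathscr{S}_{\tilde\rho,\eta\rho}(\tilde\Omega)\ \ge\ 0 .$$ Moreover, the entropy vanishes in the vacuum at time $t_0$: choosing the second ("interacting") measure equal to $\eta\rho$ (so that $\tilde M=M$), one has $$\mathscr{S}_{\eta\rho,\eta\rho}(\Omega^{t_0})=0 .$$
   Context: **Causal fermion systems.** Let $\mathcal H$ be a complex Hilbert space of finite dimension $f$ and $n\in\mathbb N$. $\mathcal F\subset \mathrm L(\mathcal H)$ is the set of symmetric operators of trace one which (counting multiplicities) have at most $n$ positive and at most $n$ negative eigenvalues, with the operator norm topology. For $x,y\in\mathcal F$ let $\lambda^{xy}_1,\dots,\lambda^{xy}_{2n}\in\mathbb C$ be the eigenvalues of $xy$ (the non-zero eigenvalues counted with algebraic multiplicity, padded by zeros). For fixed $\kappa>0$ the Lagrangian is $$\mathcal L(x,y)=\frac1{4n}\sum_{i,j=1}^{2n}\big(|\lambda^{xy}_i|-|\lambda^{xy}_j|\big)^2+\kappa\Big(\sum_{j=1}^{2n}|\lambda^{xy}_j|\Big)^2 ;$$ it is continuous and $\mathcal L(x,x)>0$ for all $x\in\mathcal F$. The causal action principle is to minimize $\iint_{\mathcal F\times\mathcal F}\mathcal L(x,y)\,d\rho(x)\,d\rho(y)$ over regular Borel measures $\rho$ on $\mathcal F$ with $\rho(\mathcal F)$ fixed (and finite). Let $\rho$ (vacuum) and $\tilde\rho$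 (interacting; its Hilbert space also has dimension $f$ and is identified with $\mathcal H$ by a unitary map) be two minimizers with compact supports $M=\operatorname{supp}\rho$, $\tilde M=\operatorname{supp}\tilde\rho$. Let $\mathcal G=\mathrm U(\mathcal H)$ with normalized Haar measure $\mu_{\mathcal G}$. **Time function and cutoff.** $M=[0,T_{\max}]\times N$ or $M=S^1\times N$ as a topological product; $S^1$ is realized as $[0,T_{\max}]$ with endpoints identified. It is assumed that $d\rho=dt\,d\mu_t$ with non-zero Borel measures $\mu_t$ on $N$. For $t\in(0,T_{\max})$, $\Omega^t=[0,t]\times N$ and $M\setminus\Omega^t=(t,T_{\max}]\times N$. Fix $t_0\in(0,T_{\max})$, $\delta>0$ and $\eta\in C^\infty((0,T_{\max}),[0,1])$ (a function of time) vanishing near $t=0$ and $t=T_{\max}$ with $\eta\equiv1$ on $(t_0-\delta,t_0+\delta)$. **Nonlinear surface layer integrals.** For $V\in\mathcal G$, $$\gamma^{t,t'}(\eta\rho,V(\eta\rho))=\Big(\int_{\Omega^t}d(\eta\rho)(x)\int_{M\setminus\Omega^{t'}}d(\eta\rho)(y)-\int_{M\setminus\Omega^t}d(\eta\rho)(x)\int_{\Omega^{t'}}d(\eta\rho)(y)\Big)\mathcal L(x,VyV^{-1}),$$ and for Borel $\tilde\Omega\subset\tilde M$, $$\gamma^{\tilde\Omega,t_0}(\tilde\rho,V(\eta\rho))=\Big(\int_{\tilde\Omega}d\tilde\rho(x)\int_{M\setminus\Omega^{t_0}}d(\eta\rho)(y)-\int_{\tilde M\setminus\tilde\Omega}d\tilde\rho(x)\int_{\Omega^{t_0}}d(\eta\rho)(y)\Big)\mathcal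 L(x,VyV^{-1}).$$ **Entropy.** For sufficiently small $\Delta t\in(0,\delta)$, $$\mathcal G^{t_0}(\Delta t)=\Big\{\mathscr U\in\mathcal G:\ \exists\,t\in(t_0-\Delta t,t_0+\Delta t)\text{ with }\gamma^{t_0,t}(\eta\rho,\mathscr U(\eta\rho))=0\text{ or }\gamma^{t_0,t}(\eta\rho,\mathscr U^{-1}(\eta\rho))=0\Big\};$$ this set has positive Haar measure, and $⨍_{\mathcal G^{t_0}(\Delta t)}(\cdots)d\mu_{\mathcal G}$ (integral with a bar) denotes the integral divided by $\mu_{\mathcal G}(\mathcal G^{t_0}(\Delta t))$. A collection $\mathfrak P(\tilde M)$ of Borel subsets of $\tilde M$, called past sets, is fixed (in the vacuum case $\tilde M=M$ it contains $\Omega^{t_0}$). A pair $(\tilde\Omega,h)\in\mathfrak P(\tilde M)\times\mathcal G$ is admissible, written $(\tilde\Omega,h)\in\mathscr A_{\tilde\rho,\eta\rho}(\Delta t)$, if $⨍_{\mathcal G^{t_0}(\Delta t)}\gamma^{\tilde\Omega,t_0}(\tilde\rho,h\mathscr U(\eta\rho))\,d\mu_{\mathcal G}(\mathscr U)=0$. Given $\beta\in\mathbb R$, $$\mathscr S_{\tilde\rho,\eta\rho}(\tilde\Omega)=\liminf_{\Delta t\searrow0}\ \inf_{h\in\mathcal G:\,(\tilde\Omega,h)\in\mathscr A_{\tilde\rho,\eta\rho}(\Delta t)}\mathscr S_{\tilde\rho,\eta\rho}(\Delta t,h),$$ $$\mathscr S_{\tilde\rho,\eta\rho}(\Delta t,h)=\inf_{\tilde\Omega'\in\mathfrak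 P(\tilde M):\,(\tilde\Omega',h)\in\mathscr A_{\tilde\rho,\eta\rho}(\Delta t)}\log ⨍_{\mathcal G^{t_0}(\Delta t)}e^{\beta\gamma^{\tilde\Omega',t_0}(\tilde\rho,h\mathscr U(\eta\rho))}\,d\mu_{\mathcal G}(\mathscr U),$$ with $\inf\varnothing=+\infty$. The quantity $\mathscr S_{\eta\rho,\eta\rho}$ is defined by the same formulas with $\tilde\rho$ replaced by $\eta\rho$ and $\tilde M$ by $M$. *)

theory Defs
  imports "HOL-Analysis.Analysis"
begin

text \<open>
  The Hilbert space of dimension \<open>f = CARD('f)\<close> is \<open>\<complex>\<^sup>f\<close> with its standard inner product, and linear
  operators are complex \<open>f \<times> f\<close> matrices. All norms on this finite-dimensional space are equivalent,
  so the topology of the type (and its Borel \<open>\<sigma>\<close>-algebra) is that of the operator norm.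
\<close>

type_synonym 'f opr = "complex ^ 'f ^ 'f"

definition adj :: "'f::finite opr \<Rightarrow> 'f opr" where
  "adj A = map_matrix cnj (transpose A)"

definition charpoly :: "'f::finite opr \<Rightarrow> complex poly" where
  "charpoly A = det (mat [:0, 1:] - map_matrix (\<lambda>c. [:c:]) A)"

definition eigvals :: "'f::finite opr \<Rightarrow> complex multiset" where
  "eigvals A = proots (charpoly A)"


section \<open>The causal action principle\<close>

definition spacetime_ops :: "nat \<Rightarrow> 'f::finite opr set" where
  "spacetime_ops n =
     {x. adj x = x \<and> trace x = 1 \<and>
         size {#z \<in># eigvals x. 0 < Re z#} \<le> n \<and> size {#z \<in># eigvals x. Re z < 0#} \<le> n}"

text \<open>
  For \<open>x, y \<in> spacetime_ops n\<close> the product has at most \<open>2 n\<close> non-zero eigenvalues (its rank is at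
  most \<open>2 n\<close>), so that the subtraction below does not truncate.
\<close>

definition prod_eigvals :: "nat \<Rightarrow> 'f::finite opr \<Rightarrow> 'f opr \<Rightarrow> complex multiset" where
  "prod_eigvals n x y =
     (let E = {#z \<in># eigvals (x ** y). z \<noteq> 0#} in E + replicate_mset (2 * n - size E) 0)"

definition lagrangian :: "nat \<Rightarrow> real \<Rightarrow> 'f::finite opr \<Rightarrow> 'f opr \<Rightarrow> real" where
  "lagrangian n \<kappa> x y =
     1 / (4 * real n) *
       (\<Sum>a\<in>#prod_eigvals n x y. \<Sum>b\<in>#prod_eigvals n x y. (cmod a - cmod b)\<^sup>2)
     + \<kappa> * (\<Sum>a\<in>#prod_eigvals n x y. cmod a)\<^sup>2"

definition regular_borel_on :: "'a::topological_space set \<Rightarrow> 'a measure \<Rightarrow> bool" where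
  "regular_borel_on F \<rho> \<longleftrightarrow>
     sets \<rho> = sets (restrict_space borel F) \<and>
     (\<forall>A\<in>sets \<rho>.
        emeasure \<rho> A = (SUP K\<in>{K. compact K \<and> K \<subseteq> A}. emeasure \<rho> K) \<and>
        emeasure \<rho> A = (INF U\<in>{U. open U \<and> A \<subseteq> U}. emeasure \<rho> (U \<inter> F)))"

definition causal_action :: "nat \<Rightarrow> real \<Rightarrow> 'f::finite opr measure \<Rightarrow> ennreal" where
  "causal_action n \<kappa> \<rho> = (\<integral>\<^sup>+x. \<integral>\<^sup>+y. ennreal (lagrangian n \<kappa> x y) \<partial>\<rho> \<partial>\<rho>)"

definition minimizer :: "nat \<Rightarrow> real \<Rightarrow> 'f::finite opr measure \<Rightarrow> bool" where
  "minimizer n \<kappa> \<rho> \<longleftrightarrow>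
     regular_borel_on (spacetime_ops n) \<rho> \<and> finite_measure \<rho> \<and>
     (\<forall>\<sigma> :: 'f opr measure. regular_borel_on (spacetime_ops n) \<sigma> \<and>
          emeasure \<sigma> (spacetime_ops n) = emeasure \<rho> (spacetime_ops n) \<longrightarrow>
          causal_action n \<kappa> \<rho> \<le> causal_action n \<kappa> \<sigma>)"

definition msupport :: "'a::topological_space measure \<Rightarrow> 'a set" where
  "msupport \<rho> = {x \<in> space \<rho>. \<forall>U. open U \<and> x \<in> U \<longrightarrow> emeasure \<rho> (U \<inter> space \<rho>) > 0}"


section \<open>The unitary group and its Haar measure\<close>

definition unitary_group :: "'f::finite opr set" where
  "unitary_group = {U. adj U ** U = mat 1 \<and> U ** adj U = mat 1}"

text \<open>
  The unitary group is a compact metrizable group, so a finite Borel measure on it is automatically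
  regular, and left invariance together with the normalization characterizes the Haar measure.
\<close>

definition normalized_haar :: "'f::finite opr measure \<Rightarrow> bool" where
  "normalized_haar \<mu>G \<longleftrightarrow>
     sets \<mu>G = sets (restrict_space borel unitary_group) \<and>
     emeasure \<mu>G unitary_group = 1 \<and>
     (\<forall>V\<in>unitary_group. \<forall>A\<in>sets \<mu>G. emeasure \<mu>G ((\<lambda>U. V ** U) ` A) = emeasure \<mu>G A)"


section \<open>Time function and cutoff\<close>

text \<open>
  Both forms of spacetime are described by a parametrization \<open>\<Phi>\<close> of \<open>M\<close> by \<open>{0..T} \<times> N\<close>. In the
  second form the circle is the unit circle of the complex plane, and \<open>\<Phi>\<close> identifies the two
  endpoints of \<open>{0..T}\<close>.
\<close>

definition interval_product ::
  "real \<Rightarrow> 'b::topological_space set \<Rightarrow> (real \<times> 'b \<Rightarrow> 'a::topological_space) \<Rightarrow> 'a set \<Rightarrow> bool"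
where
  "interval_product T N \<Phi> M \<longleftrightarrow> (\<exists>\<Theta>. homeomorphism ({0..T} \<times> N) M \<Phi> \<Theta>)"

definition circle_product ::
  "real \<Rightarrow> 'b::topological_space set \<Rightarrow> (real \<times> 'b \<Rightarrow> 'a::topological_space) \<Rightarrow> 'a set \<Rightarrow> bool"
where
  "circle_product T N \<Phi> M \<longleftrightarrow>
     (\<exists>\<Psi> \<Theta>. homeomorphism (sphere (0::complex) 1 \<times> N) M \<Psi> \<Theta> \<and>
            (\<forall>t\<in>{0..T}. \<forall>p\<in>N. \<Phi> (t, p) = \<Psi> (cis (2 * pi * t / T), p)))"

text \<open>The decomposition \<open>d\<rho> = dt d\<mu>\<^sub>t\<close> with non-zero Borel measures \<open>\<mu>\<^sub>t\<close> on \<open>N\<close>.\<close>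

definition time_disintegration ::
  "real \<Rightarrow> 'b::topological_space set \<Rightarrow> (real \<times> 'b \<Rightarrow> 'a) \<Rightarrow> 'a measure \<Rightarrow> (real \<Rightarrow> 'b measure) \<Rightarrow> bool"
where
  "time_disintegration T N \<Phi> \<rho> \<mu> \<longleftrightarrow>
     (\<forall>t\<in>{0..T}. sets (\<mu> t) = sets (restrict_space borel N) \<and> emeasure (\<mu> t) N \<noteq> 0) \<and>
     (\<forall>A\<in>sets \<rho>.
        (\<lambda>t. emeasure (\<mu> t) {p \<in> N. \<Phi> (t, p) \<in> A}) \<in> borel_measurable (lebesgue_on {0..T}) \<and>
        emeasure \<rho> A = (\<integral>\<^sup>+t. emeasure (\<mu> t) {p \<in> N. \<Phi> (t, p) \<in> A} \<partial>lebesgue_on {0..T}))"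

text \<open>
  \<open>M - past N \<Phi> t\<close> is \<open>\<Phi> ` ({t<..T} \<times> N)\<close>, except that in the circle case the points of time \<open>T\<close>,
  identified with time \<open>0\<close>, lie in the past. This is immaterial below because the cutoff vanishes
  there.
\<close>

definition past :: "'b set \<Rightarrow> (real \<times> 'b \<Rightarrow> 'a) \<Rightarrow> real \<Rightarrow> 'a set" where
  "past N \<Phi> t = \<Phi> ` ({0..t} \<times> N)"

text \<open>Only the values of \<open>\<eta>\<close> on the open interval \<open>{0<..<T}\<close> matter.\<close>

definition cutoff_function :: "real \<Rightarrow> real \<Rightarrow> real \<Rightarrow> (real \<Rightarrow> real) \<Rightarrow> bool" where
  "cutoff_function T t0 \<delta> \<eta> \<longleftrightarrow>
     (\<forall>k. (deriv ^^ k) \<eta> differentiable_on {0<..<T}) \<and>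
     (\<forall>t\<in>{0<..<T}. 0 \<le> \<eta> t \<and> \<eta> t \<le> 1) \<and>
     (\<exists>\<epsilon>>0. \<forall>t\<in>{0<..<T}. t < \<epsilon> \<or> T - \<epsilon> < t \<longrightarrow> \<eta> t = 0) \<and>
     (\<forall>t\<in>{t0 - \<delta><..<t0 + \<delta>}. \<eta> t = 1)"

text \<open>
  The cutoff as a function on spacetime. For \<open>t \<in> {0<..<T}\<close> the time of a spacetime point is unique
  also in the circle case; at the end times \<open>0\<close> and \<open>T\<close> the cutoff is extended by zero.
\<close>

definition spacetime_cutoff ::
  "real \<Rightarrow> 'b set \<Rightarrow> (real \<times> 'b \<Rightarrow> 'a) \<Rightarrow> (real \<Rightarrow> real) \<Rightarrow> 'a \<Rightarrow> real"
where
  "spacetime_cutoff T N \<Phi> \<eta> x =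
     (if x \<in> \<Phi> ` ({0<..<T} \<times> N) then \<eta> (fst (inv_into ({0<..<T} \<times> N) \<Phi> x)) else 0)"

definition cutoff_measure ::
  "real \<Rightarrow> 'b set \<Rightarrow> (real \<times> 'b \<Rightarrow> 'a) \<Rightarrow> (real \<Rightarrow> real) \<Rightarrow> 'a measure \<Rightarrow> 'a measure"
where
  "cutoff_measure T N \<Phi> \<eta> \<rho> = density \<rho> (\<lambda>x. ennreal (spacetime_cutoff T N \<Phi> \<eta> x))"


section \<open>Nonlinear surface layer integrals and entropy\<close>

text \<open>
  \<open>surface_layer L \<sigma>' M' A \<sigma> M B V\<close> is \<open>\<gamma>\<^sup>A\<^sup>,\<^sup>B(\<sigma>', V \<sigma>)\<close>, where \<open>A \<subseteq> M'\<close> and \<open>B \<subseteq> M\<close> are the pasts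
  in the spacetimes carrying \<open>\<sigma>'\<close> and \<open>\<sigma>\<close>. The spacetimes are arguments of their own because the
  one of the measure \<open>\<eta>\<rho>\<close> is \<open>supp \<rho>\<close>, not \<open>supp (\<eta>\<rho>)\<close>.
\<close>

definition surface_layer ::
  "('f::finite opr \<Rightarrow> 'f opr \<Rightarrow> real) \<Rightarrow> 'f opr measure \<Rightarrow> 'f opr set \<Rightarrow> 'f opr set \<Rightarrow>
   'f opr measure \<Rightarrow> 'f opr set \<Rightarrow> 'f opr set \<Rightarrow> 'f opr \<Rightarrow> real"
where
  "surface_layer L \<sigma>' M' A \<sigma> M B V =
     (LINT x:A|\<sigma>'. LINT y:(M - B)|\<sigma>. L x (V ** y ** matrix_inv V))
     - (LINT x:(M' - A)|\<sigma>'. LINT y:B|\<sigma>. L x (V ** y ** matrix_inv V))"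

text \<open>
  In the following \<open>\<sigma>\<close> stands for \<open>\<eta>\<rho>\<close>, \<open>M\<close> for the vacuum spacetime, \<open>\<Omega>\<close> for its family of pasts,
  \<open>\<sigma>'\<close>, \<open>M'\<close> for the second measure and its spacetime, and \<open>P'\<close> for the past sets of \<open>M'\<close>.
\<close>

definition phase_group ::
  "('f::finite opr \<Rightarrow> 'f opr \<Rightarrow> real) \<Rightarrow> 'f opr measure \<Rightarrow> 'f opr set \<Rightarrow> (real \<Rightarrow> 'f opr set) \<Rightarrow>
   real \<Rightarrow> real \<Rightarrow> 'f opr set"
where
  "phase_group L \<sigma> M \<Omega> t0 \<Delta>t =
     {U \<in> unitary_group. \<exists>t\<in>{t0 - \<Delta>t<..<t0 + \<Delta>t}.
        surface_layer L \<sigma> M (\<Omega> t0) \<sigma> M (\<Omega> t) U = 0 \<or>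
        surface_layer L \<sigma> M (\<Omega> t0) \<sigma> M (\<Omega> t) (matrix_inv U) = 0}"

definition set_average :: "'a measure \<Rightarrow> 'a set \<Rightarrow> ('a \<Rightarrow> real) \<Rightarrow> real" where
  "set_average \<mu> S g = (LINT U:S|\<mu>. g U) / measure \<mu> S"

definition admissible ::
  "'f::finite opr measure \<Rightarrow> ('f opr \<Rightarrow> 'f opr \<Rightarrow> real) \<Rightarrow> 'f opr measure \<Rightarrow> 'f opr set \<Rightarrow>
   'f opr measure \<Rightarrow> 'f opr set \<Rightarrow> (real \<Rightarrow> 'f opr set) \<Rightarrow> real \<Rightarrow> real \<Rightarrow> ('f opr set \<times> 'f opr) set"
where
  "admissible \<mu>G L \<sigma>' M' \<sigma> M \<Omega> t0 \<Delta>t =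
     {(A, h). set_average \<mu>G (phase_group L \<sigma> M \<Omega> t0 \<Delta>t)
                (\<lambda>U. surface_layer L \<sigma>' M' A \<sigma> M (\<Omega> t0) (h ** U)) = 0}"

definition entropy_at ::
  "real \<Rightarrow> 'f::finite opr measure \<Rightarrow> ('f opr \<Rightarrow> 'f opr \<Rightarrow> real) \<Rightarrow>
   'f opr measure \<Rightarrow> 'f opr set \<Rightarrow> 'f opr set set \<Rightarrow>
   'f opr measure \<Rightarrow> 'f opr set \<Rightarrow> (real \<Rightarrow> 'f opr set) \<Rightarrow> real \<Rightarrow> real \<Rightarrow> 'f opr \<Rightarrow> ereal"
where
  "entropy_at \<beta> \<mu>G L \<sigma>' M' P' \<sigma> M \<Omega> t0 \<Delta>t h =
     (INF A\<in>{A \<in> P'. (A, h) \<in> admissible \<mu>G L \<sigma>' M' \<sigma> M \<Omega> t0 \<Delta>t}.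
        ereal (ln (set_average \<mu>G (phase_group L \<sigma> M \<Omega> t0 \<Delta>t)
                     (\<lambda>U. exp (\<beta> * surface_layer L \<sigma>' M' A \<sigma> M (\<Omega> t0) (h ** U))))))"

definition entropy ::
  "real \<Rightarrow> 'f::finite opr measure \<Rightarrow> ('f opr \<Rightarrow> 'f opr \<Rightarrow> real) \<Rightarrow>
   'f opr measure \<Rightarrow> 'f opr set \<Rightarrow> 'f opr set set \<Rightarrow>
   'f opr measure \<Rightarrow> 'f opr set \<Rightarrow> (real \<Rightarrow> 'f opr set) \<Rightarrow> real \<Rightarrow> 'f opr set \<Rightarrow> ereal"
where
  "entropy \<beta> \<mu>G L \<sigma>' M' P' \<sigma> M \<Omega> t0 A =
     Liminf (at_right 0) (\<lambda>\<Delta>t.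
       INF h\<in>{h \<in> unitary_group. (A, h) \<in> admissible \<mu>G L \<sigma>' M' \<sigma> M \<Omega> t0 \<Delta>t}.
         entropy_at \<beta> \<mu>G L \<sigma>' M' P' \<sigma> M \<Omega> t0 \<Delta>t h)"

end

theory Submission
  imports Defs "HOL-Computational_Algebra.Fundamental_Theorem_Algebra"
begin

text \<open>
  Since \<open>exp u \<ge> 1 + u\<close>, the average of \<open>exp (\<beta> \<gamma>)\<close> is at least \<open>1\<close> whenever the average of \<open>\<gamma>\<close>
  vanishes; only the boundedness of \<open>\<gamma>\<close> is needed, because the average of a non-integrable
  exponential is \<open>0\<close> and \<open>ln 0 = 0\<close>. In the vacuum, the symmetry \<open>L x (U\<^sup>* y U) = L y (U x U\<^sup>*)\<close> and
  Fubini's theorem show that \<open>\<gamma>\<close> changes its sign if \<open>U\<close> is replaced by \<open>U\<^sup>*\<close>, so that the pair of the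
  past of \<open>t0\<close> and the identity is admissible by the inversion invariance of the Haar measure.
  Moreover, \<open>\<gamma>\<close> at equal times \<open>t0\<close> is uniformly small on the phase group because it vanishes there for
  some nearby \<open>t\<close> and the time slabs around \<open>t0\<close> shrink to a null set.
\<close>

section \<open>Eigenvalues\<close>

text \<open>Two obstacles shape the development. Fubini's theorem needs \<open>lagrangian\<close> to
  be jointly measurable and bounded, but it is defined through multisets of roots. It is therefore
  rewritten in terms of three quantities attached to the spectrum of \<open>x ** y\<close>: the
  number of non-zero eigenvalues and the sums of the moduli and of their squares. These are
  measurable, and they are bounded as soon as \<open>norm (x ** y)\<close> is; compactness of the
  supports and of the unitary group then yields one bound for all conjugations. The second obstacle
  is that the averages run over \<open>phase_group\<close>, whose measurability is not established.
  The estimates hence split off every case in which an integral or a quotient takes the default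
  value 0. Finally, \<open>normalized_haar\<close> states only left invariance, so invariance under
  \<open>adj\<close> has to be derived.\<close>

lemma poly_charpoly: "poly (charpoly A) w = det (mat w - A)"
proof -
  have "poly (of_int k) w = of_int k" for k by (cases k) auto
  then show ?thesis
    unfolding charpoly_def det_def
    by (simp add: poly_sum poly_prod mat_def map_matrix_def if_distrib cong: if_cong)
       (auto intro!: sum.cong prod.cong)
qed

text \<open>In the Leibniz expansion only the identity permutation reaches degree
  \<open>CARD('f)\<close>: any other one moves some index and so picks up an off-diagonal, constant
  factor.\<close>

lemma charpoly_monic:
  fixes A :: "'f::finite opr"
  shows "degree (charpoly A) = CARD('f)" "lead_coeff (charpoly A) = 1"
proof -
  define X where "X = (mat [:0, 1:] - map_matrix (\<lambda>c. [:c:]) A :: complex poly ^ 'f ^ 'f)"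
  define trm where "trm p = of_int (sign p) * (\<Prod>i\<in>UNIV. X $ i $ p i)" for p :: "'f \<Rightarrow> 'f"
  define R where "R = sum trm ({p. p permutes UNIV} - {id})"
  have X: "X $ i $ j = (if i = j then [:- (A $ i $ j), 1:] else [:- (A $ i $ j):])" for i j
    by (simp add: X_def mat_def map_matrix_def)
  have split: "charpoly A = trm id + R"
    unfolding charpoly_def det_def R_def
    by (subst sum.remove[symmetric]) (auto simp: trm_def X_def permutes_id)
  have deg_id: "degree (trm id) = CARD('f)"
    by (simp add: trm_def X degree_prod_sum_eq)
  have lead_id: "lead_coeff (trm id) = 1"
    by (simp add: trm_def X lead_coeff_prod del: degree_prod_sum_eq)
  have "degree (trm p) < CARD('f)" if p: "p permutes UNIV" "p \<noteq> id" for p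
  proof -
    have "degree (trm p) \<le> degree (\<Prod>i\<in>UNIV. X $ i $ p i)"
      by (cases rule: sign_cases[of p]) (auto simp: trm_def)
    also have "\<dots> \<le> (\<Sum>i\<in>UNIV. degree (X $ i $ p i))"
      using degree_prod_sum_le[of UNIV "\<lambda>i. X $ i $ p i"] by (simp add: o_def)
    also have "\<dots> \<le> (\<Sum>i\<in>UNIV. if p i = i then 1 else 0)"
      by (intro sum_mono) (auto simp: X)
    also have "\<dots> < (\<Sum>i\<in>(UNIV::'f set). 1)"
    proof (rule sum_strict_mono_ex1)
      show "\<exists>a\<in>UNIV. (if p a = a then 1 else 0) < (1::nat)"
        using p(2) by (auto simp: fun_eq_iff)
    qed auto
    finally show ?thesis by simp
  qed
  then have deg_R: "degree R < degree (trm id)"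
    unfolding R_def deg_id by (intro degree_sum_less) auto
  show "degree (charpoly A) = CARD('f)"
    unfolding split using deg_R deg_id by (simp add: degree_add_eq_left)
  show "lead_coeff (charpoly A) = 1"
    unfolding split using deg_R lead_id by (simp add: degree_add_eq_left coeff_eq_0)
qed

lemma charpoly_eq_prod_eigvals: "charpoly A = (\<Prod>x\<in>#eigvals A. [:- x, 1:])"
  using complex_poly_decompose_multiset[of "charpoly A"]
  by (simp only: charpoly_monic(2) eigvals_def smult_1_left)

lemma size_eigvals: "size (eigvals (A :: 'f::finite opr)) = CARD('f)"
  by (simp add: eigvals_def size_proots_complex charpoly_monic)

text \<open>Complex polynomials agree iff their values do. The right-hand side mentions no roots and
  is continuous in \<open>z\<close> and \<open>A\<close>, which makes it the closed condition behind
  the measurability proof.\<close>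

lemma eigvals_eq_iff:
  fixes A :: "'f::finite opr" and z :: "complex ^ 'f"
  shows "eigvals A = image_mset (($) z) (mset_set UNIV)
         \<longleftrightarrow> (\<forall>w. det (mat w - A) = (\<Prod>i\<in>UNIV. w - z $ i))"
proof
  assume "eigvals A = image_mset (($) z) (mset_set UNIV)"
  then have "charpoly A = (\<Prod>i\<in>UNIV. [:- (z $ i), 1:])"
    by (simp add: charpoly_eq_prod_eigvals prod_unfold_prod_mset image_mset.compositionality o_def)
  then show "\<forall>w. det (mat w - A) = (\<Prod>i\<in>UNIV. w - z $ i)"
    by (simp add: poly_charpoly[symmetric] poly_prod)
next
  assume "\<forall>w. det (mat w - A) = (\<Prod>i\<in>UNIV. w - z $ i)"
  then have "poly (charpoly A) = poly (\<Prod>i\<in>UNIV. [:- (z $ i), 1:])"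
    by (auto simp: fun_eq_iff poly_charpoly poly_prod)
  then have "charpoly A = (\<Prod>i\<in>UNIV. [:- (z $ i), 1:])"
    by (simp only: poly_eq_poly_eq_iff)
  moreover have "(\<Sum>i\<in>I. {#z $ i#}) = image_mset (($) z) (mset_set I)" if "finite I" for I
    using that by induction auto
  ultimately show "eigvals A = image_mset (($) z) (mset_set UNIV)"
    by (simp add: eigvals_def proots_prod)
qed

text \<open>There are exactly \<open>CARD('f)\<close> roots with multiplicity, so any enumeration of
  them can be reindexed by \<open>'f\<close>. The order is arbitrary and never has to be chosen
  consistently in \<open>A\<close>.\<close>

lemma eigvals_tuple:
  fixes A :: "'f::finite opr"
  obtains z :: "complex ^ 'f" where "eigvals A = image_mset (($) z) (mset_set UNIV)"
proof -
  obtain xs where xs: "mset xs = eigvals A"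
    using ex_mset[of "eigvals A"] by auto
  then have len: "length xs = CARD('f)"
    using size_eigvals[of A] size_mset[of xs] by simp
  obtain g where g: "bij_betw g (UNIV :: 'f set) {0..<CARD('f)}"
    using ex_bij_betw_finite_nat[of "UNIV :: 'f set"] by auto
  define z :: "complex ^ 'f" where "z = (\<chi> i. xs ! g i)"
  have "image_mset (($) z) (mset_set UNIV) = image_mset ((!) xs) (image_mset g (mset_set UNIV))"
  proof -
    have "(($) z) = (!) xs \<circ> g"
      by (simp add: z_def fun_eq_iff)
    then show ?thesis
      by (simp only: image_mset.compositionality)
  qed
  also have "image_mset g (mset_set UNIV) = mset [0..<length xs]"
    using g by (simp add: image_mset_mset_set bij_betw_def len)
  also have "image_mset ((!) xs) (mset [0..<length xs]) = eigvals A"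
    using mset_map[of "(!) xs" "[0..<length xs]"] by (simp only: map_nth xs)
  finally show ?thesis using that[of z] by simp
qed

section \<open>Invariance of the spectrum under exchange of two factors\<close>

lemma matrix_sub_ldistrib: "A ** (B - C) = A ** B - A ** C" for A :: "'a::ring_1^'n::finite^'m"
  by (simp add: vec_eq_iff matrix_matrix_mult_def sum_subtractf right_diff_distrib)

lemma matrix_sub_rdistrib: "(B - C) ** A = B ** A - C ** A" for B :: "'a::ring_1^'n::finite^'m"
  by (simp add: vec_eq_iff matrix_matrix_mult_def sum_subtractf left_diff_distrib)

lemma mat_mult_commute: "A ** mat w = mat w ** A" for A :: "'f::finite opr"
  by (simp add: vec_eq_iff matrix_matrix_mult_def mat_def if_distrib if_distribR mult.commute cong: if_cong)

text \<open>If \<open>A\<close> is invertible, \<open>AB\<close> and \<open>BA\<close> are similar; in general, perturb \<open>A\<close> to \<open>A + e\<close>.\<close>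

lemma eigvals_mult_commute: "eigvals (A ** B) = eigvals (B ** A)" for A :: "'f::finite opr"
proof -
  have "det (mat w - A ** B) = det (mat w - B ** A)" for w
  proof -
    define X where "X e = mat e + A" for e
    define d where "d e = det (mat w - X e ** B) - det (mat w - B ** X e)" for e
    \<comment> \<open>As a monic polynomial in \<open>e\<close>, the determinant has finitely many
      zeros, hence none in a punctured neighbourhood of 0, whatever \<open>A\<close> is.\<close>
    have det_X: "det (X e) = poly (charpoly (- A)) e" for e
      unfolding X_def poly_charpoly by simp
    have d0: "d e = 0" if "det (X e) \<noteq> 0" for e
    proof -
      have "X e ** (mat w - B ** X e) = (mat w - X e ** B) ** X e"
        by (simp add: mat_mult_commute matrix_sub_ldistrib matrix_sub_rdistrib matrix_mul_assoc)
      then have "det (X e) * det (mat w - B ** X e) = det (mat w - X e ** B) * det (X e)"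
        by (metis det_mul)
      then show ?thesis using that by (simp add: d_def)
    qed
    have "charpoly (- A) \<noteq> 0"
      using charpoly_monic(2)[of "- A"] by force
    then have "finite {e. det (X e) = 0}"
      by (simp add: det_X poly_roots_finite)
    then have "eventually (\<lambda>e. det (X e) \<noteq> 0) (at 0)"
      using islimpt_finite[of "{e. det (X e) = 0}" 0] by (simp add: islimpt_iff_eventually)
    then have "eventually (\<lambda>e. d e = 0) (at 0)"
      by eventually_elim (rule d0)
    then have "(d \<longlongrightarrow> 0) (at 0)"
      by (simp add: tendsto_eventually)
    moreover have "isCont d 0"
    proof -
      have "isCont (\<lambda>e::complex. if i = j then e else 0) 0" for i j :: 'f
        by (cases "i = j") auto
      then show ?thesis
        unfolding d_def det_def X_def matrix_matrix_mult_def mat_def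
        by (auto intro!: continuous_intros)
    qed
    ultimately have "d 0 = 0"
      by (metis LIM_unique isCont_def)
    moreover have "X 0 = A" by (simp add: X_def vec_eq_iff mat_def)
    ultimately show ?thesis by (simp add: d_def)
  qed
  moreover obtain z :: "complex ^ 'f" where "eigvals (A ** B) = image_mset (($) z) (mset_set UNIV)"
    by (rule eigvals_tuple[of "A ** B"])
  ultimately show ?thesis
    using eigvals_eq_iff[of "A ** B" z] eigvals_eq_iff[of "B ** A" z] by simp
qed

section \<open>Measurability of symmetric functions of the eigenvalues\<close>

lemma sum_eigvals_tuple:
  fixes z :: "complex ^ 'f::finite"
  assumes "eigvals A = image_mset (($) z) (mset_set UNIV)"
  shows "(\<Sum>a\<in>#eigvals A. g a) = (\<Sum>i\<in>UNIV. g (z $ i))"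
  using assms by (simp add: sum_unfold_sum_mset image_mset.compositionality o_def)

text \<open>
  The sublevel sets are \<open>F\<^sub>\<sigma>\<close>: they are countable unions of projections along compact balls of tuples
  of eigenvalues. This avoids the continuity of the roots.
\<close>

lemma borel_measurable_sum_eigvals:
  fixes g :: "complex \<Rightarrow> real"
  assumes g: "continuous_on UNIV g"
  shows "(\<lambda>A::'f::finite opr. \<Sum>a\<in>#eigvals A. g a) \<in> borel_measurable borel"
proof (subst borel_measurable_iff_le, rule allI)
  fix c :: real
  define T where "T = {(z :: complex ^ 'f, A :: 'f opr).
      (\<forall>w. det (mat w - A) = (\<Prod>i\<in>UNIV. w - z $ i)) \<and> (\<Sum>i\<in>UNIV. g (z $ i)) \<le> c}"
  have cg: "continuous_on UNIV (\<lambda>x :: (complex ^ 'f) \<times> 'f opr. g (fst x $ i))" for i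
    by (rule continuous_on_compose2[OF g]) (auto intro!: continuous_intros)
  have "T = (\<Inter>w. {x. det (mat w - snd x) = (\<Prod>i\<in>UNIV. w - fst x $ i)}) \<inter>
            {x. (\<Sum>i\<in>UNIV. g (fst x $ i)) \<le> c}"
    by (auto simp: T_def)
  also have "closed \<dots>"
    unfolding det_def
    by (intro closed_Int closed_INT ballI closed_Collect_eq closed_Collect_le)
       (auto intro!: continuous_intros cg)
  finally have "closed T" .
  then have cl: "closed {A. \<exists>z. z \<in> cball 0 (real m) \<and> (z, A) \<in> T}" for m
    by (intro closed_compact_projection compact_cball)
  have "{A. (\<Sum>a\<in>#eigvals A. g a) \<le> c} = (\<Union>m. {A. \<exists>z. z \<in> cball 0 (real m) \<and> (z, A) \<in> T})"
  proof (intro equalityI subsetI; clarsimp)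
    fix A :: "'f opr" assume le: "(\<Sum>a\<in>#eigvals A. g a) \<le> c"
    obtain z :: "complex ^ 'f" where z: "eigvals A = image_mset (($) z) (mset_set UNIV)"
      by (rule eigvals_tuple[of A])
    have "(z, A) \<in> T"
      using le z eigvals_eq_iff[of A z] unfolding T_def sum_eigvals_tuple[OF z] by simp
    then show "\<exists>m z. norm z \<le> real m \<and> (z, A) \<in> T"
      using real_arch_simple[of "norm z"] by blast
  next
    fix A :: "'f opr" and z :: "complex ^ 'f"
    assume "(z, A) \<in> T"
    then have z: "eigvals A = image_mset (($) z) (mset_set UNIV)" and "(\<Sum>i\<in>UNIV. g (z $ i)) \<le> c"
      using eigvals_eq_iff[of A z] by (auto simp: T_def)
    then show "(\<Sum>a\<in>#eigvals A. g a) \<le> c"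
      unfolding sum_eigvals_tuple[OF z] by simp
  qed
  then show "{A \<in> space borel. (\<Sum>a\<in>#eigvals (A :: 'f opr). g a) \<le> c} \<in> sets borel"
    using cl by (auto intro!: sets.countable_UN)
qed

text \<open>The indicator of \<open>a \<noteq> 0\<close> is discontinuous, so the preceding lemma is
  applied to the continuous functions \<open>min 1 (real m * cmod a)\<close>, which increase to
  it.\<close>

lemma borel_measurable_count_nonzero_eigvals:
  "(\<lambda>A::'f::finite opr. real (size {#a \<in># eigvals A. a \<noteq> 0#})) \<in> borel_measurable borel"
proof (rule borel_measurable_LIMSEQ_real)
  fix A :: "'f opr"
  have lim: "(\<lambda>m. min 1 (real m * cmod a)) \<longlonglongrightarrow> (if a \<noteq> 0 then 1 else 0)" for a :: complex
  proof (cases "a = 0")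
    case False
    have "eventually (\<lambda>m. 1 / cmod a \<le> real m) sequentially"
      by real_asymp
    then have "eventually (\<lambda>m. min 1 (real m * cmod a) = 1) sequentially"
      by eventually_elim (use False in \<open>auto simp: field_simps min_def\<close>)
    then show ?thesis using False by (simp add: tendsto_eventually)
  qed auto
  have "(\<lambda>m. \<Sum>a\<in>#E. min 1 (real m * cmod a)) \<longlonglongrightarrow> real (size {#a \<in># E. a \<noteq> 0#})" for E
  proof (induction E)
    case (add a E)
    then show ?case using tendsto_add[OF lim[of a] add.IH] by (auto split: if_splits)
  qed auto
  then show "(\<lambda>m. \<Sum>a\<in>#eigvals A. min 1 (real m * cmod a))
      \<longlonglongrightarrow> real (size {#a \<in># eigvals A. a \<noteq> 0#})" .
next
  show "(\<lambda>A::'f opr. \<Sum>a\<in>#eigvals A. min 1 (real m * cmod a)) \<in> borel_measurable borel" for m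
    by (intro borel_measurable_sum_eigvals continuous_intros)
qed

section \<open>The Lagrangian as a measurable function with local bounds\<close>

lemma sum_mset_sq_diff:
  fixes f :: "'a \<Rightarrow> real"
  shows "(\<Sum>a\<in>#E. \<Sum>b\<in>#E. (f a - f b)\<^sup>2)
         = 2 * real (size E) * (\<Sum>a\<in>#E. (f a)\<^sup>2) - 2 * (\<Sum>a\<in>#E. f a)\<^sup>2"
proof -
  \<comment> \<open>A separate multiset \<open>F\<close> carries the induction, since
    \<open>E\<close> occurs twice in the double sum.\<close>
  have inner: "(\<Sum>b\<in>#F. (c - f b)\<^sup>2)
      = real (size F) * c\<^sup>2 - 2 * c * (\<Sum>b\<in>#F. f b) + (\<Sum>b\<in>#F. (f b)\<^sup>2)" for c F
    by (induction F) (auto simp: algebra_simps power2_eq_square)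
  \<comment> \<open>To be used with \<open>u\<close> the size of \<open>E\<close>, \<open>v\<close>
    the sum of \<open>f\<close> and \<open>w\<close> the sum of its squares, as left over by the
    inner sum.\<close>
  have "(\<Sum>a\<in>#F. u * (f a)\<^sup>2 - 2 * f a * v + w)
      = u * (\<Sum>a\<in>#F. (f a)\<^sup>2) - 2 * v * (\<Sum>a\<in>#F. f a) + real (size F) * w" for u v w F
    by (induction F) (auto simp: algebra_simps)
  then show ?thesis
    unfolding inner by (simp add: power2_eq_square)
qed

text \<open>The padding zeros enter only through the size of the padded multiset. Under truncated
  subtraction this size is the \<open>max\<close>, which makes the formula valid for arbitrary
  matrices and not just for pairs in \<open>spacetime_ops n\<close>.\<close>

lemma lagrangian_eq:
  fixes x y :: "'f::finite opr"
  shows "lagrangian n \<kappa> x y =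
    1 / (4 * real n) *
      (2 * max (2 * real n) (real (size {#a \<in># eigvals (x ** y). a \<noteq> 0#}))
         * (\<Sum>a\<in>#eigvals (x ** y). (cmod a)\<^sup>2) - 2 * (\<Sum>a\<in>#eigvals (x ** y). cmod a)\<^sup>2)
    + \<kappa> * (\<Sum>a\<in>#eigvals (x ** y). cmod a)\<^sup>2"
proof -
  have drop0: "(\<Sum>a\<in>#{#a \<in># E. a \<noteq> 0#}. g a) = (\<Sum>a\<in>#E. g a)"
    if "g 0 = 0" for g :: "complex \<Rightarrow> real" and E
    using that by (induction E) auto
  have "(\<Sum>a\<in>#prod_eigvals n x y. g a) = (\<Sum>a\<in>#eigvals (x ** y). g a)"
    if "g 0 = 0" for g :: "complex \<Rightarrow> real"
    using that by (simp add: prod_eigvals_def Let_def drop0)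
  moreover have "real (size (prod_eigvals n x y)) =
      max (2 * real n) (real (size {#a \<in># eigvals (x ** y). a \<noteq> 0#}))"
    by (simp add: prod_eigvals_def Let_def max_def of_nat_diff)
  ultimately show ?thesis
    unfolding lagrangian_def sum_mset_sq_diff by simp
qed

lemma continuous_on_matrix_mult [continuous_intros]:
  fixes f g :: "_ \<Rightarrow> 'f::finite opr"
  assumes "continuous_on S f" "continuous_on S g"
  shows "continuous_on S (\<lambda>x. f x ** g x)"
  unfolding matrix_matrix_mult_def by (intro continuous_intros assms)

lemma borel_measurable_lagrangian:
  "(\<lambda>p::'f::finite opr \<times> 'f opr. lagrangian n \<kappa> (fst p) (snd p)) \<in> borel_measurable borel"
proof -
  have [measurable]: "(\<lambda>p::'f opr \<times> 'f opr. fst p ** snd p) \<in> borel_measurable borel"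
    by (intro borel_measurable_continuous_onI continuous_intros)
  note borel_measurable_count_nonzero_eigvals [measurable]
  have [measurable]: "(\<lambda>A::'f opr. \<Sum>a\<in>#eigvals A. (cmod a)\<^sup>2) \<in> borel_measurable borel"
      "(\<lambda>A::'f opr. \<Sum>a\<in>#eigvals A. cmod a) \<in> borel_measurable borel"
    by (intro borel_measurable_sum_eigvals continuous_intros)+
  show ?thesis
    unfolding lagrangian_eq by measurable
qed

lemma lagrangian_cong:
  "eigvals (x ** y) = eigvals (x' ** y') \<Longrightarrow> lagrangian n \<kappa> x y = lagrangian n \<kappa> x' y'"
  by (simp add: lagrangian_eq)

text \<open>Read the eigenvalue equation in the row where the eigenvector has its entry of largest
  modulus: each of the \<open>CARD('f)\<close> terms there is at most \<open>norm A\<close> times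
  that modulus.\<close>

lemma cmod_eigval_le:
  fixes A :: "'f::finite opr"
  assumes "a \<in># eigvals A"
  shows "cmod a \<le> real CARD('f) * norm A"
proof -
  have "poly (charpoly A) a = 0"
    unfolding charpoly_eq_prod_eigvals poly_prod_mset using assms
    by (auto simp: prod_mset_zero_iff image_iff)
  then have "\<not> invertible (mat a - A)"
    by (simp add: poly_charpoly invertible_det_nz)
  then obtain v where v: "(mat a - A) *v v = 0" "v \<noteq> 0"
    by (metis invertible_left_inverse matrix_left_invertible_ker)
  have "mat a *v v = a *s v"
    by (simp add: vec_eq_iff matrix_vector_mult_def mat_def
        if_distrib if_distribR vector_scalar_mult_def cong: if_cong)
  then have "(mat a - A) *v v = a *s v - A *v v"
    by (simp add: matrix_vector_mult_diff_rdistrib)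
  with v(1) have av: "a * v $ i = (\<Sum>j\<in>UNIV. A $ i $ j * v $ j)" for i
    by (simp add: vec_eq_iff matrix_vector_mult_def)
  define m where "m = Max (range (\<lambda>i. cmod (v $ i)))"
  have le_m: "cmod (v $ i) \<le> m" for i
    unfolding m_def by (intro Max_ge) auto
  have "m \<in> range (\<lambda>i. cmod (v $ i))"
    unfolding m_def by (intro Max_in) auto
  then obtain i where i: "m = cmod (v $ i)" by auto
  have "m > 0"
  proof -
    obtain j where "v $ j \<noteq> 0" using v(2) by (auto simp: vec_eq_iff)
    then show ?thesis using le_m[of j] by (smt (verit) zero_less_norm_iff)
  qed
  have "cmod a * m = cmod (\<Sum>j\<in>UNIV. A $ i $ j * v $ j)"
    by (simp add: i norm_mult flip: av)
  also have "\<dots> \<le> (\<Sum>j\<in>(UNIV::'f set). norm A * m)"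
  proof (rule sum_norm_le)
    fix j
    have "cmod (A $ i $ j) \<le> norm A"
      using Finite_Cartesian_Product.norm_nth_le[of "A $ i" j]
        Finite_Cartesian_Product.norm_nth_le[of A i] by linarith
    then show "cmod (A $ i $ j * v $ j) \<le> norm A * m"
      by (simp add: norm_mult mult_mono le_m)
  qed
  also have "\<dots> = real CARD('f) * norm A * m" by simp
  finally show ?thesis using \<open>m > 0\<close> by simp
qed

lemma lagrangian_bounded:
  "\<exists>C. \<forall>x y :: 'f::finite opr. norm (x ** y) \<le> R \<longrightarrow> \<bar>lagrangian n \<kappa> x y\<bar> \<le> C"
proof -
  \<comment> \<open>\<open>d\<close> counts all eigenvalues, \<open>r\<close> bounds their moduli,
    and \<open>m\<close> bounds the \<open>max\<close> in \<open>lagrangian_eq\<close>. The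
    difference in that formula is estimated by a sum, whence the plus sign in
    \<open>C\<close>.\<close>
  define d where "d = real CARD('f)"
  define r where "r = d * R"
  define m where "m = 2 * real n + d"
  define C where "C = 1 / (4 * real n) * (2 * m * (d * r\<^sup>2) + 2 * (d * r)\<^sup>2) + \<bar>\<kappa>\<bar> * (d * r)\<^sup>2"
  have "\<bar>lagrangian n \<kappa> x y\<bar> \<le> C" if xy: "norm (x ** y) \<le> R" for x y :: "'f opr"
  proof -
    let ?E = "eigvals (x ** y)"
    define k where "k = max (2 * real n) (real (size {#a \<in># ?E. a \<noteq> 0#}))"
    define S1 where "S1 = (\<Sum>a\<in>#?E. cmod a)"
    define S2 where "S2 = (\<Sum>a\<in>#?E. (cmod a)\<^sup>2)"
    have le_r: "cmod a \<le> r" if "a \<in># ?E" for a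
      using cmod_eigval_le[OF that] mult_left_mono[OF xy, of d] unfolding r_def d_def by linarith
    have sum_le: "(\<Sum>a\<in>#E. g a) \<le> real (size E) * c" if "\<And>a. a \<in># E \<Longrightarrow> g a \<le> c"
      for E :: "complex multiset" and g c
      using that by (induction E) (auto simp: algebra_simps add_mono)
    have sum_ge: "0 \<le> (\<Sum>a\<in>#E. g a)" if "\<And>a. 0 \<le> g a"
      for E :: "complex multiset" and g :: "complex \<Rightarrow> real"
      using that by (induction E) auto
    have S1: "0 \<le> S1" "S1 \<le> d * r"
      using sum_ge[of cmod] sum_le[of ?E cmod r] le_r
      by (auto simp: S1_def size_eigvals d_def)
    have S2: "0 \<le> S2" "S2 \<le> d * r\<^sup>2"
      using sum_ge[of "\<lambda>a. (cmod a)\<^sup>2"] sum_le[of ?E "\<lambda>a. (cmod a)\<^sup>2" "r\<^sup>2"] le_r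
      by (auto simp: S2_def size_eigvals d_def power_mono)
    have k: "0 \<le> k" "k \<le> m"
      using size_filter_mset_lesseq[of "\<lambda>a. a \<noteq> 0" ?E]
      by (auto simp: k_def m_def d_def size_eigvals)
    have S1sq: "S1\<^sup>2 \<le> (d * r)\<^sup>2" "0 \<le> S1\<^sup>2"
      using S1 by (auto intro: power_mono)
    have "\<bar>2 * k * S2 - 2 * S1\<^sup>2\<bar> \<le> 2 * m * (d * r\<^sup>2) + 2 * (d * r)\<^sup>2"
      using mult_mono[OF k(2) S2(2) _ S2(1)] k S1sq mult_nonneg_nonneg[OF k(1) S2(1)]
      unfolding abs_le_iff mult.assoc[of 2] by linarith
    then have "\<bar>1 / (4 * real n) * (2 * k * S2 - 2 * S1\<^sup>2)\<bar>
        \<le> 1 / (4 * real n) * (2 * m * (d * r\<^sup>2) + 2 * (d * r)\<^sup>2)"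
      unfolding abs_mult by (intro mult_mono) auto
    moreover have "\<bar>\<kappa> * S1\<^sup>2\<bar> \<le> \<bar>\<kappa>\<bar> * (d * r)\<^sup>2"
      using S1sq by (simp add: abs_mult mult_left_mono)
    ultimately have "\<bar>1 / (4 * real n) * (2 * k * S2 - 2 * S1\<^sup>2) + \<kappa> * S1\<^sup>2\<bar> \<le> C"
      unfolding C_def by linarith
    then show ?thesis
      unfolding lagrangian_eq k_def S1_def S2_def .
  qed
  then show ?thesis by auto
qed

section \<open>The unitary group and its Haar measure\<close>

lemma adj_adj [simp]: "adj (adj A) = A"
  by (simp add: adj_def map_matrix_def transpose_def vec_eq_iff)

lemma continuous_on_adj [continuous_intros]:
  fixes f :: "_ \<Rightarrow> 'f::finite opr"
  assumes "continuous_on S f"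
  shows "continuous_on S (\<lambda>x. adj (f x))"
  unfolding adj_def map_matrix_def transpose_def by (auto intro!: continuous_intros assms)

text \<open>\<open>matrix_inv\<close> is a Hilbert choice, so the uniqueness of the two-sided
  inverse is what identifies it.\<close>

lemma matrix_inv_unitary:
  assumes "U \<in> unitary_group"
  shows "matrix_inv U = adj U"
  unfolding matrix_inv_def
proof (rule some_equality)
  show "U ** adj U = mat 1 \<and> adj U ** U = mat 1"
    using assms by (simp add: unitary_group_def)
  fix B assume B: "U ** B = mat 1 \<and> B ** U = mat 1"
  have "B = (adj U ** U) ** B"
    using assms by (simp add: unitary_group_def)
  also have "\<dots> = adj U"
    using B by (simp flip: matrix_mul_assoc)
  finally show "B = adj U" .
qed

lemma adj_mult: "adj (A ** B) = adj B ** adj A"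
  by (simp add: adj_def map_matrix_def transpose_def vec_eq_iff matrix_matrix_mult_def mult.commute)

lemma adj_unitary: "U \<in> unitary_group \<Longrightarrow> adj U \<in> unitary_group"
  by (simp add: unitary_group_def)

lemma mult_unitary:
  assumes "U \<in> unitary_group" "V \<in> unitary_group"
  shows "U ** V \<in> unitary_group"
proof -
  have "adj V ** adj U ** (U ** V) = adj V ** (adj U ** U) ** V"
       "U ** V ** (adj V ** adj U) = U ** (V ** adj V) ** adj U"
    by (simp_all only: matrix_mul_assoc)
  then show ?thesis
    using assms by (simp add: unitary_group_def adj_mult)
qed

lemma mat_1_unitary: "(mat 1 :: 'f::finite opr) \<in> unitary_group"
proof -
  have "adj (mat 1) = (mat 1 :: 'f opr)"
    by (simp add: adj_def map_matrix_def transpose_def mat_def vec_eq_iff)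
  then show ?thesis by (simp add: unitary_group_def)
qed

lemma unitary_cancel:
  assumes "U \<in> unitary_group"
  shows "adj U ** (U ** A) = A" "U ** (adj U ** A) = A"
proof -
  have U: "adj U ** U = mat 1" "U ** adj U = mat 1"
    using assms by (simp_all add: unitary_group_def)
  show "adj U ** (U ** A) = A" "U ** (adj U ** A) = A"
    unfolding matrix_mul_assoc U by simp_all
qed

lemma compact_unitary_group: "compact (unitary_group :: 'f::finite opr set)"
proof -
  have "closed (unitary_group :: 'f opr set)"
    unfolding unitary_group_def
    by (intro closed_Collect_conj closed_Collect_eq continuous_intros)
  moreover have "bounded (unitary_group :: 'f opr set)"
  proof (rule boundedI)
    fix U :: "'f opr" assume U: "U \<in> unitary_group"
    \<comment> \<open>The squared norms of the rows are the diagonal entries of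
      \<open>U ** adj U\<close>.\<close>
    have "(norm (U $ i))\<^sup>2 = 1" for i
    proof -
      have "complex_of_real ((norm (U $ i))\<^sup>2) = (\<Sum>j\<in>UNIV. U $ i $ j * cnj (U $ i $ j))"
        by (simp add: norm_vec_def L2_set_def sum_nonneg del: of_real_power flip: complex_norm_square)
      also have "\<dots> = (U ** adj U) $ i $ i"
        by (simp add: matrix_matrix_mult_def adj_def map_matrix_def transpose_def)
      also have "\<dots> = 1"
        using U by (simp add: unitary_group_def mat_def)
      finally show ?thesis by (simp only: of_real_eq_1_iff)
    qed
    then show "norm U \<le> sqrt (real CARD('f))"
      by (simp add: norm_vec_def[of U] L2_set_def)
  qed
  ultimately show ?thesis by (simp add: compact_eq_bounded_closed)
qed

text \<open>Split the product on the left as \<open>(x ** adj U) ** (y ** U)\<close> and exchange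
  the two factors.\<close>

lemma lagrangian_swap_conj:
  assumes "U \<in> unitary_group"
  shows "lagrangian n \<kappa> x (adj U ** y ** U) = lagrangian n \<kappa> y (U ** x ** adj U)"
proof (rule lagrangian_cong)
  show "eigvals (x ** (adj U ** y ** U)) = eigvals (y ** (U ** x ** adj U))"
    using eigvals_mult_commute[of "x ** adj U" "y ** U"] by (simp add: matrix_mul_assoc)
qed

text \<open>The triples \<open>(x, y, V)\<close> form a compact set, on which the continuous product
  has bounded norm. Uniformity in \<open>V\<close> is what later bounds the surface layer integrals
  on the whole group.\<close>

lemma lagrangian_conj_bounded:
  fixes K K' :: "'f::finite opr set"
  assumes "compact K" "compact K'"
  shows "\<exists>C\<ge>0. \<forall>x\<in>K'. \<forall>y\<in>K. \<forall>V\<in>unitary_group.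
           \<bar>lagrangian n \<kappa> x (V ** y ** matrix_inv V)\<bar> \<le> C"
proof -
  let ?f = "\<lambda>(x :: 'f opr, y :: 'f opr, V :: 'f opr). x ** (V ** y ** adj V)"
  have "compact (?f ` (K' \<times> K \<times> unitary_group))"
    by (intro compact_continuous_image compact_Times assms compact_unitary_group)
       (auto simp: split_def intro!: continuous_intros)
  then obtain R where "\<forall>z \<in> ?f ` (K' \<times> K \<times> unitary_group). norm z \<le> R"
    using compact_imp_bounded[of "?f ` (K' \<times> K \<times> unitary_group)"] unfolding bounded_iff by auto
  then have R: "\<And>z. z \<in> ?f ` (K' \<times> K \<times> unitary_group) \<Longrightarrow> norm z \<le> R"
    by (rule bspec)
  obtain C where C: "\<forall>x y :: 'f opr. norm (x ** y) \<le> R \<longrightarrow> \<bar>lagrangian n \<kappa> x y\<bar> \<le> C"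
    using lagrangian_bounded[where 'f = 'f and R = R and n = n and \<kappa> = \<kappa>] by (rule exE)
  show ?thesis
  proof (intro exI[of _ "max C 0"] conjI ballI)
    fix x y V :: "'f opr" assume "x \<in> K'" "y \<in> K" "V \<in> unitary_group"
    then have "norm (x ** (V ** y ** adj V)) \<le> R"
      by (intro R image_eqI[where x = "(x, y, V)"]) auto
    then have "\<bar>lagrangian n \<kappa> x (V ** y ** adj V)\<bar> \<le> C"
      using C by simp
    then show "\<bar>lagrangian n \<kappa> x (V ** y ** matrix_inv V)\<bar> \<le> max C 0"
      using \<open>V \<in> unitary_group\<close> by (simp add: matrix_inv_unitary)
  qed auto
qed

lemma normalized_haar_space:
  assumes "normalized_haar \<mu>G"
  shows "space \<mu>G = unitary_group"
proof -
  have "space \<mu>G = space (restrict_space borel unitary_group)"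
    using assms by (intro sets_eq_imp_space_eq) (simp add: normalized_haar_def)
  then show ?thesis by (simp add: space_restrict_space)
qed

lemma normalized_haar_prob:
  assumes "normalized_haar \<mu>G"
  shows "emeasure \<mu>G (space \<mu>G) = 1"
  using assms by (simp add: normalized_haar_space) (simp add: normalized_haar_def)

lemma measurable_into_unitary:
  assumes \<mu>: "normalized_haar \<mu>G"
    and "f \<in> M \<rightarrow>\<^sub>M borel" "\<And>x. x \<in> space M \<Longrightarrow> f x \<in> unitary_group"
  shows "f \<in> M \<rightarrow>\<^sub>M \<mu>G"
proof -
  have "f \<in> M \<rightarrow>\<^sub>M restrict_space borel unitary_group"
    using assms(2,3) by (intro measurable_restrict_space2) auto
  then show ?thesis
    using \<mu> by (simp add: normalized_haar_def cong: measurable_cong_sets)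
qed

lemma measurable_haar_borel:
  assumes \<mu>: "normalized_haar \<mu>G"
  shows "(\<lambda>U. U) \<in> \<mu>G \<rightarrow>\<^sub>M borel"
proof -
  have "(\<lambda>U. U) \<in> restrict_space borel unitary_group \<rightarrow>\<^sub>M borel"
    by (intro measurable_restrict_space1) auto
  then show ?thesis
    using \<mu> by (simp add: normalized_haar_def cong: measurable_cong_sets)
qed

text \<open>\<open>normalized_haar\<close> speaks of images, the change of variables of preimages;
  the preimage under multiplication by \<open>V\<close> is the image under multiplication by
  \<open>adj V\<close>.\<close>

lemma haar_left_translate:
  fixes \<mu>G :: "'f::finite opr measure"
  assumes \<mu>: "normalized_haar \<mu>G" and V: "V \<in> unitary_group"
  shows "(\<lambda>U. V ** U) \<in> \<mu>G \<rightarrow>\<^sub>M \<mu>G" "distr \<mu>G \<mu>G (\<lambda>U. V ** U) = \<mu>G"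
proof -
  note sp = normalized_haar_space[OF \<mu>]
  note measurable_haar_borel[OF \<mu>, measurable]
  have "(\<lambda>A :: 'f opr. V ** A) \<in> borel_measurable borel"
    by (rule borel_measurable_continuous_onI)
       (rule continuous_on_matrix_mult[OF continuous_on_const continuous_on_id])
  then show meas: "(\<lambda>U. V ** U) \<in> \<mu>G \<rightarrow>\<^sub>M \<mu>G"
    using V by (intro measurable_into_unitary[OF \<mu>]) (auto simp: sp mult_unitary)
  show "distr \<mu>G \<mu>G (\<lambda>U. V ** U) = \<mu>G"
  proof (rule measure_eqI)
    fix A assume "A \<in> sets (distr \<mu>G \<mu>G (\<lambda>U. V ** U))"
    then have A: "A \<in> sets \<mu>G" by simp
    then have AG: "A \<subseteq> unitary_group" using sets.sets_into_space sp by blast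
    have "(\<lambda>U. V ** U) -` A \<inter> space \<mu>G = (\<lambda>U. adj V ** U) ` A"
    proof (intro equalityI subsetI)
      fix U assume "U \<in> (\<lambda>U. V ** U) -` A \<inter> space \<mu>G"
      then show "U \<in> (\<lambda>U. adj V ** U) ` A"
        using V by (intro image_eqI[of _ _ "V ** U"]) (auto simp: unitary_cancel)
    next
      fix U assume "U \<in> (\<lambda>U. adj V ** U) ` A"
      then show "U \<in> (\<lambda>U. V ** U) -` A \<inter> space \<mu>G"
        using V AG by (auto simp: unitary_cancel sp intro!: mult_unitary adj_unitary)
    qed
    then have "emeasure (distr \<mu>G \<mu>G (\<lambda>U. V ** U)) A = emeasure \<mu>G ((\<lambda>U. adj V ** U) ` A)"
      using emeasure_distr[OF meas A] by simp
    also have "\<dots> = emeasure \<mu>G A"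
      using \<mu> A adj_unitary[OF V] by (auto simp: normalized_haar_def)
    finally show "emeasure (distr \<mu>G \<mu>G (\<lambda>U. V ** U)) A = emeasure \<mu>G A" .
  qed simp
qed

text \<open>
  Left invariance and Tonelli's theorem give
  \<open>\<mu> A = \<integral>\<integral> 1\<^sub>A (U\<^sup>* V) dV dU = \<integral>\<integral> 1\<^sub>A ((V\<^sup>* U)\<^sup>*) dU dV = \<integral> 1\<^sub>A (U\<^sup>*) dU\<close>.
\<close>

lemma haar_adj:
  fixes \<mu>G :: "'f::finite opr measure"
  assumes \<mu>: "normalized_haar \<mu>G"
  shows "adj \<in> \<mu>G \<rightarrow>\<^sub>M \<mu>G" "distr \<mu>G \<mu>G adj = \<mu>G"
proof -
  note sp = normalized_haar_space[OF \<mu>]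
  note incl = measurable_haar_borel[OF \<mu>]
  note one = normalized_haar_prob[OF \<mu>]
  interpret finite_measure \<mu>G
    by standard (simp add: one)
  interpret pair_sigma_finite \<mu>G \<mu>G ..
  have "adj \<in> borel_measurable borel"
    by (intro borel_measurable_continuous_onI continuous_intros)
  then show meas: "adj \<in> \<mu>G \<rightarrow>\<^sub>M \<mu>G"
    using measurable_compose[OF incl]
    by (intro measurable_into_unitary[OF \<mu>]) (auto simp: sp adj_unitary)
  have "(\<lambda>p :: 'f opr \<times> 'f opr. adj (fst p) ** snd p) \<in> borel_measurable (borel \<Otimes>\<^sub>M borel)"
    unfolding borel_prod by (intro borel_measurable_continuous_onI continuous_intros)
  moreover have "(\<lambda>p. (fst p, snd p)) \<in> \<mu>G \<Otimes>\<^sub>M \<mu>G \<rightarrow>\<^sub>M borel \<Otimes>\<^sub>M borel"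
    by (intro measurable_Pair measurable_compose[OF measurable_fst incl]
        measurable_compose[OF measurable_snd incl])
  ultimately have "(\<lambda>p :: 'f opr \<times> 'f opr. adj (fst p) ** snd p) \<in> borel_measurable (\<mu>G \<Otimes>\<^sub>M \<mu>G)"
    by (simp add: measurable_compose)
  then have meas2: "(\<lambda>p :: 'f opr \<times> 'f opr. adj (fst p) ** snd p) \<in> \<mu>G \<Otimes>\<^sub>M \<mu>G \<rightarrow>\<^sub>M \<mu>G"
    by (intro measurable_into_unitary[OF \<mu>])
       (auto simp: space_pair_measure sp adj_unitary mult_unitary)
  have translate: "(\<integral>\<^sup>+U. f (V ** U) \<partial>\<mu>G) = (\<integral>\<^sup>+U. f U \<partial>\<mu>G)"
    if "f \<in> borel_measurable \<mu>G" "V \<in> unitary_group" for f V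
    using nn_integral_distr[OF haar_left_translate(1)[OF \<mu> that(2)], of f] that
    by (simp add: haar_left_translate(2)[OF \<mu> that(2)])
  show "distr \<mu>G \<mu>G adj = \<mu>G"
  proof (rule measure_eqI)
    fix A assume "A \<in> sets (distr \<mu>G \<mu>G adj)"
    then have A: "A \<in> sets \<mu>G" by simp
    then have ind: "indicator A \<in> borel_measurable \<mu>G" by simp
    let ?f = "\<lambda>U V. indicator A (adj U ** V) :: ennreal"
    have "emeasure \<mu>G A = (\<integral>\<^sup>+U. \<integral>\<^sup>+V. ?f U V \<partial>\<mu>G \<partial>\<mu>G)"
    proof -
      have "(\<integral>\<^sup>+V. ?f U V \<partial>\<mu>G) = emeasure \<mu>G A" if "U \<in> space \<mu>G" for U
        using translate[OF ind, of "adj U"] that A by (simp add: sp adj_unitary)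
      then have "(\<integral>\<^sup>+U. \<integral>\<^sup>+V. ?f U V \<partial>\<mu>G \<partial>\<mu>G) = (\<integral>\<^sup>+U. emeasure \<mu>G A \<partial>\<mu>G)"
        by (intro nn_integral_cong) auto
      then show ?thesis by (simp add: one)
    qed
    also have "\<dots> = (\<integral>\<^sup>+V. \<integral>\<^sup>+U. ?f U V \<partial>\<mu>G \<partial>\<mu>G)"
      using measurable_compose[OF meas2 ind] by (intro Fubini'[symmetric]) (simp add: split_def)
    also have "\<dots> = (\<integral>\<^sup>+V. (\<integral>\<^sup>+U. indicator A (adj U) \<partial>\<mu>G) \<partial>\<mu>G)"
    proof (rule nn_integral_cong)
      fix V assume "V \<in> space \<mu>G"
      then have V: "adj V \<in> unitary_group" by (simp add: sp adj_unitary)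
      have "?f U V = indicator A (adj (adj V ** U))" for U
        by (simp add: adj_mult)
      then show "(\<integral>\<^sup>+U. ?f U V \<partial>\<mu>G) = (\<integral>\<^sup>+U. indicator A (adj U) \<partial>\<mu>G)"
        using translate[OF measurable_compose[OF meas ind] V] by simp
    qed
    also have "\<dots> = emeasure (distr \<mu>G \<mu>G adj) A"
      using nn_integral_distr[OF meas, of "indicator A"] A by (simp add: one)
    finally show "emeasure (distr \<mu>G \<mu>G adj) A = emeasure \<mu>G A" by simp
  qed simp
qed

lemma haar_integral_adj:
  fixes g :: "_ \<Rightarrow> real"
  assumes \<mu>: "normalized_haar \<mu>G" and g: "integrable \<mu>G g"
  shows "(LINT U|\<mu>G. g (adj U)) = (LINT U|\<mu>G. g U)"
  using integral_distr[OF haar_adj(1)[OF \<mu>], of g] g by (simp add: haar_adj(2)[OF \<mu>])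

section \<open>Surface layer integrals\<close>

text \<open>A non-integrable function has integral 0 by convention, which obeys the bound too. The
  lemma can therefore be nested in iterated integrals whose inner integral is of unknown
  measurability.\<close>

lemma abs_set_lebesgue_integral_le:
  fixes g :: "_ \<Rightarrow> real"
  assumes "finite_measure \<nu>" and "0 \<le> C" and g: "\<And>x. x \<in> A \<Longrightarrow> \<bar>g x\<bar> \<le> C"
  shows "\<bar>LINT x:A|\<nu>. g x\<bar> \<le> C * measure \<nu> (space \<nu>)"
proof (cases "set_integrable \<nu> A g")
  case True
  interpret finite_measure \<nu> by fact
  have "\<bar>LINT x:A|\<nu>. g x\<bar> \<le> (LINT x|\<nu>. norm (indicator A x *\<^sub>R g x))"
    unfolding set_lebesgue_integral_def
    using integral_norm_bound[of \<nu> "\<lambda>x. indicator A x *\<^sub>R g x"] by simp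
  also have "\<dots> \<le> (LINT x|\<nu>. C)"
  proof (rule integral_mono)
    show "integrable \<nu> (\<lambda>x. norm (indicator A x *\<^sub>R g x))"
      using True unfolding set_integrable_def by (rule integrable_norm)
    show "norm (indicator A x *\<^sub>R g x) \<le> C" for x
      using g[of x] \<open>0 \<le> C\<close> by (auto simp: indicator_def)
  qed simp
  finally show ?thesis by (simp add: mult.commute)
next
  case False
  then show ?thesis
    using \<open>0 \<le> C\<close>
    by (simp add: set_integrable_def set_lebesgue_integral_def not_integrable_integral_eq)
qed

lemma abs_surface_layer_le:
  assumes "finite_measure \<sigma>" "finite_measure \<sigma>'" and "0 \<le> C"
    and C: "\<And>x y. x \<in> M' \<Longrightarrow> y \<in> M \<Longrightarrow> \<bar>L x (V ** y ** matrix_inv V)\<bar> \<le> C"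
    and "A \<subseteq> M'" "B \<subseteq> M"
  shows "\<bar>surface_layer L \<sigma>' M' A \<sigma> M B V\<bar>
         \<le> 2 * (C * measure \<sigma> (space \<sigma>) * measure \<sigma>' (space \<sigma>'))"
proof -
  have "\<bar>LINT x:S|\<sigma>'. LINT y:T|\<sigma>. L x (V ** y ** matrix_inv V)\<bar>
        \<le> C * measure \<sigma> (space \<sigma>) * measure \<sigma>' (space \<sigma>')" if "S \<subseteq> M'" "T \<subseteq> M" for S T
    by (rule abs_set_lebesgue_integral_le[OF assms(2)], use \<open>0 \<le> C\<close> in simp,
        rule abs_set_lebesgue_integral_le[OF assms(1) \<open>0 \<le> C\<close>]) (use that C in auto)
  from this[of A "M - B"] this[of "M' - A" B] show ?thesis
    using assms(5,6) unfolding surface_layer_def by force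
qed

text \<open>The indicators stay in the integrand because the Lagrangian is bounded only over the
  compact supports, while the measures live on a larger space.\<close>

lemma integrable_times_indicator:
  fixes G :: "_ \<Rightarrow> real"
  assumes "finite_measure \<nu>" "finite_measure \<sigma>"
    and G: "G \<in> borel_measurable (\<nu> \<Otimes>\<^sub>M \<sigma>)"
    and ST: "S \<in> sets \<nu>" "T \<in> sets \<sigma>"
    and C: "\<And>x y. x \<in> S \<Longrightarrow> y \<in> T \<Longrightarrow> \<bar>G (x, y)\<bar> \<le> C"
  shows "integrable (\<nu> \<Otimes>\<^sub>M \<sigma>) (\<lambda>p. indicator S (fst p) * indicator T (snd p) * G p)"
proof (rule integrableI_bounded_set[where A = "S \<times> T" and B = C])
  interpret N: finite_measure \<nu> by fact
  interpret S: finite_measure \<sigma> by fact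
  show "S \<times> T \<in> sets (\<nu> \<Otimes>\<^sub>M \<sigma>)" using ST by simp
  have "indicator S \<in> borel_measurable \<nu>" "indicator T \<in> borel_measurable \<sigma>"
    using ST by simp_all
  then show "(\<lambda>p. indicator S (fst p) * indicator T (snd p) * G p) \<in> borel_measurable (\<nu> \<Otimes>\<^sub>M \<sigma>)"
    by (intro borel_measurable_times G measurable_compose[OF measurable_fst]
        measurable_compose[OF measurable_snd])
  show "emeasure (\<nu> \<Otimes>\<^sub>M \<sigma>) (S \<times> T) < \<infinity>"
    using N.emeasure_finite[of S, unfolded infinity_ennreal_def top.not_eq_extremum]
      S.emeasure_finite[of T, unfolded infinity_ennreal_def top.not_eq_extremum]
    by (simp only: S.emeasure_pair_measure_Times[OF ST] infinity_ennreal_def ennreal_mult_less_top simp_thms)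
qed (use C in \<open>auto simp: indicator_def\<close>)

lemma set_integral_times:
  fixes G :: "_ \<Rightarrow> real"
  assumes "finite_measure \<nu>" "finite_measure \<sigma>"
    and "G \<in> borel_measurable (\<nu> \<Otimes>\<^sub>M \<sigma>)"
    and "S \<in> sets \<nu>" "T \<in> sets \<sigma>"
    and "\<And>x y. x \<in> S \<Longrightarrow> y \<in> T \<Longrightarrow> \<bar>G (x, y)\<bar> \<le> C"
  shows "(LINT x:S|\<nu>. LINT y:T|\<sigma>. G (x, y))
         = (LINT p|(\<nu> \<Otimes>\<^sub>M \<sigma>). indicator S (fst p) * indicator T (snd p) * G p)"
proof -
  interpret N: finite_measure \<nu> by fact
  interpret S: finite_measure \<sigma> by fact
  interpret pair_sigma_finite \<nu> \<sigma> ..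
  show ?thesis
    using integral_fst'[OF integrable_times_indicator[OF assms], symmetric]
    unfolding set_lebesgue_integral_def by (simp add: mult.assoc)
qed

text \<open>\<open>F\<close> is the set of operators carrying the measure; it need not be a Borel set.\<close>

locale layer_space =
  fixes L :: "'f::finite opr \<Rightarrow> 'f opr \<Rightarrow> real" and \<sigma> :: "'f opr measure" and F M :: "'f opr set"
    and C :: real
  assumes L_measurable: "(\<lambda>p. L (fst p) (snd p)) \<in> borel_measurable borel"
    and L_swap: "\<And>x y U. U \<in> unitary_group \<Longrightarrow> L x (adj U ** y ** U) = L y (U ** x ** adj U)"
    and finite_\<sigma>: "finite_measure \<sigma>"
    and sets_\<sigma>: "sets \<sigma> = sets (restrict_space borel F)"
    and M_sets: "M \<in> sets \<sigma>"
    and C_nonneg: "0 \<le> C"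
    and L_bound: "\<And>x y V. x \<in> M \<Longrightarrow> y \<in> M \<Longrightarrow> V \<in> unitary_group \<Longrightarrow>
                    \<bar>L x (V ** y ** matrix_inv V)\<bar> \<le> C"
begin

abbreviation "\<gamma> A B \<equiv> surface_layer L \<sigma> M A \<sigma> M B"

text \<open>Integrating against this kernel merges the two iterated integrals of
  \<open>surface_layer\<close> into one over the product measure; sign changes and variations of the
  past can then be read off the kernel.\<close>

definition layer_kernel :: "'f opr set \<Rightarrow> 'f opr set \<Rightarrow> 'f opr \<times> 'f opr \<Rightarrow> real" where
  "layer_kernel A B p = indicator A (fst p) * indicator (M - B) (snd p)
                  - indicator (M - A) (fst p) * indicator B (snd p)"

lemma L_conj_measurable:
  "(\<lambda>p. L (fst p) (V ** snd p ** W)) \<in> borel_measurable (\<sigma> \<Otimes>\<^sub>M \<sigma>)"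
proof -
  have "(\<lambda>x. x) \<in> restrict_space borel F \<rightarrow>\<^sub>M (borel :: 'f opr measure)"
    by (intro measurable_restrict_space1) auto
  then have incl: "(\<lambda>x. x) \<in> \<sigma> \<rightarrow>\<^sub>M borel"
    by (simp add: sets_\<sigma> cong: measurable_cong_sets)
  have "(\<lambda>p. (fst p, snd p)) \<in> \<sigma> \<Otimes>\<^sub>M \<sigma> \<rightarrow>\<^sub>M (borel \<Otimes>\<^sub>M borel :: ('f opr \<times> 'f opr) measure)"
    by (intro measurable_Pair measurable_compose[OF measurable_fst incl]
        measurable_compose[OF measurable_snd incl])
  then have p: "(\<lambda>p. p) \<in> \<sigma> \<Otimes>\<^sub>M \<sigma> \<rightarrow>\<^sub>M (borel :: ('f opr \<times> 'f opr) measure)"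
    by (simp add: borel_prod)
  have "(\<lambda>p :: 'f opr \<times> 'f opr. (fst p, V ** snd p ** W)) \<in> borel \<rightarrow>\<^sub>M borel"
    by (intro borel_measurable_continuous_onI continuous_on_Pair continuous_on_matrix_mult
        continuous_on_fst continuous_on_snd continuous_on_const continuous_on_id)
  then show ?thesis
    using measurable_compose[OF measurable_compose[OF p, of "\<lambda>p. (fst p, V ** snd p ** W)"] L_measurable]
    by simp
qed

lemma kernel_integrable:
  assumes "A \<in> sets \<sigma>" "A \<subseteq> M" "B \<in> sets \<sigma>" "B \<subseteq> M" "V \<in> unitary_group"
  shows "integrable (\<sigma> \<Otimes>\<^sub>M \<sigma>) (\<lambda>p. layer_kernel A B p * L (fst p) (V ** snd p ** matrix_inv V))"
    and "\<gamma> A B V = (LINT p|(\<sigma> \<Otimes>\<^sub>M \<sigma>). layer_kernel A B p * L (fst p) (V ** snd p ** matrix_inv V))"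
proof -
  let ?G = "\<lambda>p. L (fst p) (V ** snd p ** matrix_inv V)"
  note * = finite_\<sigma> finite_\<sigma> L_conj_measurable[of V "matrix_inv V"]
  have bd: "\<bar>?G (x, y)\<bar> \<le> C" if "x \<in> M" "y \<in> M" for x y
    using L_bound[OF that assms(5)] by simp
  have i1: "integrable (\<sigma> \<Otimes>\<^sub>M \<sigma>) (\<lambda>p. indicator A (fst p) * indicator (M - B) (snd p) * ?G p)"
    by (rule integrable_times_indicator[OF *, where C = C]) (use assms M_sets bd in auto)
  have i2: "integrable (\<sigma> \<Otimes>\<^sub>M \<sigma>) (\<lambda>p. indicator (M - A) (fst p) * indicator B (snd p) * ?G p)"
    by (rule integrable_times_indicator[OF *, where C = C]) (use assms M_sets bd in auto)
  show "integrable (\<sigma> \<Otimes>\<^sub>M \<sigma>) (\<lambda>p. layer_kernel A B p * ?G p)"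
    unfolding layer_kernel_def left_diff_distrib by (rule Bochner_Integration.integrable_diff[OF i1 i2])
  have "(LINT x:A|\<sigma>. LINT y:M - B|\<sigma>. ?G (x, y))
      = (LINT p|(\<sigma> \<Otimes>\<^sub>M \<sigma>). indicator A (fst p) * indicator (M - B) (snd p) * ?G p)"
    by (rule set_integral_times[OF *, where C = C]) (use assms M_sets bd in auto)
  moreover have "(LINT x:M - A|\<sigma>. LINT y:B|\<sigma>. ?G (x, y))
      = (LINT p|(\<sigma> \<Otimes>\<^sub>M \<sigma>). indicator (M - A) (fst p) * indicator B (snd p) * ?G p)"
    by (rule set_integral_times[OF *, where C = C]) (use assms M_sets bd in auto)
  ultimately show "\<gamma> A B V = (LINT p|(\<sigma> \<Otimes>\<^sub>M \<sigma>). layer_kernel A B p * ?G p)"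
    unfolding surface_layer_def layer_kernel_def left_diff_distrib
    using Bochner_Integration.integral_diff[OF i1 i2] by simp
qed

text \<open>Equal pasts make \<open>layer_kernel A A\<close> antisymmetric. Exchanging the
  integration variables thus produces the sign, and \<open>L_swap\<close> restores the Lagrangian
  with \<open>U\<close> in place of \<open>adj U\<close>.\<close>

lemma surface_layer_adj:
  assumes A: "A \<in> sets \<sigma>" "A \<subseteq> M" and U: "U \<in> unitary_group"
  shows "\<gamma> A A (adj U) = - \<gamma> A A U"
proof -
  interpret finite_measure \<sigma> by (rule finite_\<sigma>)
  interpret pair_sigma_finite \<sigma> \<sigma> ..
  let ?f = "\<lambda>p. layer_kernel A A p * L (fst p) (U ** snd p ** adj U)"
  have kernel_swap: "layer_kernel A A (x, y) = - layer_kernel A A (y, x)" for x y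
    by (simp add: layer_kernel_def)
  have U': "adj U \<in> unitary_group" using U by (rule adj_unitary)
  have "\<gamma> A A (adj U) = (LINT p|(\<sigma> \<Otimes>\<^sub>M \<sigma>). layer_kernel A A p * L (fst p) (adj U ** snd p ** U))"
    using kernel_integrable(2)[OF A A U'] by (simp add: matrix_inv_unitary U')
  also have "\<dots> = (LINT p|(\<sigma> \<Otimes>\<^sub>M \<sigma>). - (case p of (x, y) \<Rightarrow> ?f (y, x)))"
  proof (rule Bochner_Integration.integral_cong[OF refl], clarify)
    fix x y
    show "layer_kernel A A (x, y) * L (fst (x, y)) (adj U ** snd (x, y) ** U) = - ?f (y, x)"
      using kernel_swap[of x y] by (simp add: L_swap[OF U])
  qed
  also have "\<dots> = - (LINT p|(\<sigma> \<Otimes>\<^sub>M \<sigma>). ?f p)"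
    using integral_product_swap[of ?f] kernel_integrable(1)[OF A A U]
    by (simp add: matrix_inv_unitary[OF U] split_def)
  also have "\<dots> = - \<gamma> A A U"
    using kernel_integrable(2)[OF A A U] by (simp add: matrix_inv_unitary U)
  finally show ?thesis .
qed

text \<open>The kernels for \<open>B\<close> and \<open>B'\<close> differ only where the second
  argument lies in the symmetric difference, which \<open>D\<close> contains.\<close>

lemma surface_layer_diff_le:
  assumes A: "A \<in> sets \<sigma>" "A \<subseteq> M" and B: "B \<in> sets \<sigma>" "B \<subseteq> M" and B': "B' \<in> sets \<sigma>" "B' \<subseteq> M"
    and V: "V \<in> unitary_group" and D: "D \<in> sets \<sigma>" "D \<subseteq> M" "B - B' \<subseteq> D" "B' - B \<subseteq> D"
  shows "\<bar>\<gamma> A B V - \<gamma> A B' V\<bar> \<le> C * measure \<sigma> M * measure \<sigma> D"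
proof -
  let ?G = "\<lambda>p. L (fst p) (V ** snd p ** matrix_inv V)"
  let ?I = "\<lambda>p. indicator M (fst p) * indicator D (snd p) * C"
  note i = kernel_integrable[OF A B V] kernel_integrable[OF A B' V]
  have "\<gamma> A B V - \<gamma> A B' V
      = (LINT p|(\<sigma> \<Otimes>\<^sub>M \<sigma>). layer_kernel A B p * ?G p - layer_kernel A B' p * ?G p)"
    using Bochner_Integration.integral_diff[OF i(1,3)] i(2,4) by simp
  also have "\<bar>\<dots>\<bar> \<le> (LINT p|(\<sigma> \<Otimes>\<^sub>M \<sigma>). ?I p)"
    unfolding real_norm_def[symmetric]
  proof (rule Bochner_Integration.integral_norm_bound_integral)
    show "integrable (\<sigma> \<Otimes>\<^sub>M \<sigma>) (\<lambda>p. layer_kernel A B p * ?G p - layer_kernel A B' p * ?G p)"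
      by (rule Bochner_Integration.integrable_diff[OF i(1,3)])
    show "integrable (\<sigma> \<Otimes>\<^sub>M \<sigma>) ?I"
      by (rule integrable_times_indicator[OF finite_\<sigma> finite_\<sigma>, where C = C])
         (use M_sets D C_nonneg in auto)
    show "norm (layer_kernel A B p * ?G p - layer_kernel A B' p * ?G p) \<le> ?I p" for p
    proof (cases "fst p \<in> M \<and> snd p \<in> D")
      case True
      \<comment> \<open>The two summands of the kernel sit over the disjoint sets \<open>A\<close>
        and \<open>M - A\<close> of first arguments, so the bound is 1 and not 2.\<close>
      have "\<bar>layer_kernel A B p - layer_kernel A B' p\<bar> \<le> 1"
        using True D(2) by (auto simp: layer_kernel_def indicator_def)
      moreover have "\<bar>?G p\<bar> \<le> C"
        using True D(2) by (intro L_bound V) auto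
      ultimately have "\<bar>layer_kernel A B p - layer_kernel A B' p\<bar> * \<bar>?G p\<bar> \<le> 1 * C"
        by (intro mult_mono) auto
      then show ?thesis
        using True by (simp add: abs_mult flip: left_diff_distrib)
    next
      case False
      then have "layer_kernel A B p = layer_kernel A B' p"
        using A(2) B(2) B'(2) D(3,4) by (auto simp: layer_kernel_def indicator_def)
      then show ?thesis using C_nonneg by simp
    qed
  qed
  also have "\<dots> = (LINT x:M|\<sigma>. LINT y:D|\<sigma>. C)"
    by (rule set_integral_times[OF finite_\<sigma> finite_\<sigma>, where C = C, symmetric])
       (use M_sets D C_nonneg in auto)
  also have "\<dots> = C * measure \<sigma> M * measure \<sigma> D"
    using M_sets D(1) finite_measure.emeasure_finite[OF finite_\<sigma>]
    by (simp add: set_lebesgue_integral_def sets.Int_space_eq2)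
  finally show ?thesis .
qed

end

section \<open>Entropy\<close>

text \<open>Integrating \<open>1 + u \<le> exp u\<close> needs \<open>u\<close> integrable, while
  \<open>g\<close> comes without measurability; it is recovered from the integrable
  exponential.\<close>

lemma ln_set_average_exp_nonneg:
  assumes fin: "finite_measure \<nu>" and avg: "set_average \<nu> S g = 0"
    and C: "\<And>U. U \<in> S \<Longrightarrow> \<bar>g U\<bar> \<le> C"
  shows "0 \<le> ln (set_average \<nu> S (\<lambda>U. exp (\<beta> * g U)))"
proof (cases "measure \<nu> S = 0 \<or> \<not> set_integrable \<nu> S (\<lambda>U. exp (\<beta> * g U))")
  case True
  then have "set_average \<nu> S (\<lambda>U. exp (\<beta> * g U)) = 0"
    by (auto simp: set_average_def set_lebesgue_integral_def set_integrable_def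
        not_integrable_integral_eq)
  then show ?thesis by simp
next
  case False
  interpret finite_measure \<nu> by fact
  have pos: "measure \<nu> S > 0" and S: "S \<in> sets \<nu>"
    using False measure_notin_sets[of S \<nu>] by (auto simp: zero_less_measure_iff)
  have ind: "(indicator S :: _ \<Rightarrow> real) \<in> borel_measurable \<nu>" "integrable \<nu> (indicator S :: _ \<Rightarrow> real)"
    using S by (auto intro: integrable_const_bound[where B = 1])
  define h where "h = (\<lambda>U. indicator S U * exp (\<beta> * g U))"
  define u where "u U = indicator S U * (\<beta> * g U)" for U
  have h: "integrable \<nu> h"
    using False by (simp add: set_integrable_def h_def)
  \<comment> \<open>Taking the logarithm of \<open>h\<close> shows that \<open>u\<close> is
    measurable; integrability then follows from the bound on \<open>g\<close>.\<close>
  have "u = (\<lambda>U. indicator S U * ln (h U))"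
    by (auto simp: u_def h_def indicator_def fun_eq_iff)
  then have "u \<in> borel_measurable \<nu>"
    using ind(1) borel_measurable_integrable[OF h] by simp
  moreover have "norm (u U) \<le> \<bar>\<beta>\<bar> * \<bar>C\<bar>" for U
    using C[of U] by (auto simp: u_def indicator_def abs_mult intro!: mult_left_mono)
  ultimately have u: "integrable \<nu> u"
    by (intro integrable_const_bound[where B = "\<bar>\<beta>\<bar> * \<bar>C\<bar>"]) auto
  have "integral\<^sup>L \<nu> u = (LINT U|\<nu>. \<beta> * (indicator S U * g U))"
    by (intro Bochner_Integration.integral_cong) (auto simp: u_def)
  also have "\<dots> = 0"
    using avg pos by (simp add: set_average_def set_lebesgue_integral_def)
  finally have "measure \<nu> S = (LINT U|\<nu>. indicator S U + u U)"
    using ind u S by (simp add: sets.Int_space_eq2)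
  also have "\<dots> \<le> integral\<^sup>L \<nu> h"
    using exp_ge_add_one_self
    by (intro integral_mono Bochner_Integration.integrable_add ind u h)
       (auto simp: h_def u_def indicator_def)
  finally have "1 \<le> set_average \<nu> S (\<lambda>U. exp (\<beta> * g U))"
    using pos by (simp add: set_average_def set_lebesgue_integral_def h_def)
  then show ?thesis by simp
qed

lemma ln_set_average_exp_le:
  assumes fin: "finite_measure \<nu>" and \<epsilon>: "\<And>U. U \<in> S \<Longrightarrow> \<bar>g U\<bar> \<le> \<epsilon>" "0 \<le> \<epsilon>"
  shows "ln (set_average \<nu> S (\<lambda>U. exp (\<beta> * g U))) \<le> \<bar>\<beta>\<bar> * \<epsilon>"
proof (cases "measure \<nu> S = 0 \<or> \<not> set_integrable \<nu> S (\<lambda>U. exp (\<beta> * g U))")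
  case True
  then have "set_average \<nu> S (\<lambda>U. exp (\<beta> * g U)) = 0"
    by (auto simp: set_average_def set_lebesgue_integral_def set_integrable_def
        not_integrable_integral_eq)
  then show ?thesis using \<epsilon> by simp
next
  case False
  interpret finite_measure \<nu> by fact
  have pos: "measure \<nu> S > 0" and S: "S \<in> sets \<nu>"
    using False measure_notin_sets[of S \<nu>] by (auto simp: zero_less_measure_iff)
  have ind: "integrable \<nu> (\<lambda>U. indicator S U * exp (\<bar>\<beta>\<bar> * \<epsilon>))"
    using S by (intro integrable_mult_left) (auto intro: integrable_const_bound[where B = 1])
  have le: "exp (\<beta> * g U) \<le> exp (\<bar>\<beta>\<bar> * \<epsilon>)" if "U \<in> S" for U
  proof -
    have "\<beta> * g U \<le> \<bar>\<beta>\<bar> * \<bar>g U\<bar>"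
      by (metis abs_ge_self abs_mult)
    then show ?thesis
      using mult_left_mono[OF \<epsilon>(1)[OF that] abs_ge_zero[of \<beta>]] by simp
  qed
  have "(LINT U:S|\<nu>. exp (\<beta> * g U)) \<le> (LINT U|\<nu>. indicator S U * exp (\<bar>\<beta>\<bar> * \<epsilon>))"
    unfolding set_lebesgue_integral_def using False le
    by (intro integral_mono ind) (auto simp: set_integrable_def indicator_def)
  also have "\<dots> = measure \<nu> S * exp (\<bar>\<beta>\<bar> * \<epsilon>)"
    using S by (simp add: sets.Int_space_eq2)
  finally have le: "set_average \<nu> S (\<lambda>U. exp (\<beta> * g U)) \<le> exp (\<bar>\<beta>\<bar> * \<epsilon>)"
    using pos by (simp add: set_average_def field_simps)
  show ?thesis
  \<comment> \<open>\<open>ln\<close> is monotone only on positive arguments; at 0 its default value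
    0 satisfies the bound as well.\<close>
  proof (cases "set_average \<nu> S (\<lambda>U. exp (\<beta> * g U)) > 0")
    case True
    then have "ln (set_average \<nu> S (\<lambda>U. exp (\<beta> * g U))) \<le> ln (exp (\<bar>\<beta>\<bar> * \<epsilon>))"
      using le by (subst ln_le_cancel_iff) auto
    then show ?thesis by simp
  next
    case False
    moreover have "set_average \<nu> S (\<lambda>U. exp (\<beta> * g U)) \<ge> 0"
      unfolding set_average_def set_lebesgue_integral_def
      by (intro divide_nonneg_nonneg Bochner_Integration.integral_nonneg) auto
    ultimately show ?thesis using \<epsilon>(2) by (simp add: order.antisym)
  qed
qed

lemma phase_group_unitary: "U \<in> phase_group L \<sigma> M \<Omega> t0 \<Delta>t \<Longrightarrow> U \<in> unitary_group"
  by (simp add: phase_group_def)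

text \<open>Passing to the inverse just exchanges the two alternatives in
  \<open>phase_group\<close>.\<close>

lemma phase_group_adj_iff:
  assumes "U \<in> unitary_group"
  shows "adj U \<in> phase_group L \<sigma> M \<Omega> t0 \<Delta>t \<longleftrightarrow> U \<in> phase_group L \<sigma> M \<Omega> t0 \<Delta>t"
  using assms adj_unitary[OF assms]
  by (auto simp: phase_group_def matrix_inv_unitary)

text \<open>Every number entering the two infima is non-negative and an empty infimum is
  \<infinity>, so the bound holds at each \<open>\<Delta>t\<close>, before the limit. The past set
  \<open>A\<close> enters only through the choice of \<open>h\<close>.\<close>

lemma entropy_nonneg:
  assumes \<mu>G: "finite_measure \<mu>G" and fin: "finite_measure \<sigma>" "finite_measure \<sigma>'" and "0 \<le> C"
    and C: "\<And>x y V. x \<in> M' \<Longrightarrow> y \<in> M \<Longrightarrow> V \<in> unitary_group \<Longrightarrow>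
              \<bar>L x (V ** y ** matrix_inv V)\<bar> \<le> C"
    and P': "\<And>A. A \<in> P' \<Longrightarrow> A \<subseteq> M'" and \<Omega>: "\<Omega> t0 \<subseteq> M"
  shows "0 \<le> entropy \<beta> \<mu>G L \<sigma>' M' P' \<sigma> M \<Omega> t0 A"
  unfolding entropy_def
proof (intro Liminf_bounded always_eventually allI INF_greatest)
  fix \<Delta>t h
  assume h: "h \<in> {h \<in> unitary_group. (A, h) \<in> admissible \<mu>G L \<sigma>' M' \<sigma> M \<Omega> t0 \<Delta>t}"
  show "0 \<le> entropy_at \<beta> \<mu>G L \<sigma>' M' P' \<sigma> M \<Omega> t0 \<Delta>t h"
    unfolding entropy_at_def
  proof (rule INF_greatest)
    fix A' assume A': "A' \<in> {A \<in> P'. (A, h) \<in> admissible \<mu>G L \<sigma>' M' \<sigma> M \<Omega> t0 \<Delta>t}"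
    have "0 \<le> ln (set_average \<mu>G (phase_group L \<sigma> M \<Omega> t0 \<Delta>t)
                   (\<lambda>U. exp (\<beta> * surface_layer L \<sigma>' M' A' \<sigma> M (\<Omega> t0) (h ** U))))"
    proof (rule ln_set_average_exp_nonneg[OF \<mu>G])
      show "set_average \<mu>G (phase_group L \<sigma> M \<Omega> t0 \<Delta>t)
              (\<lambda>U. surface_layer L \<sigma>' M' A' \<sigma> M (\<Omega> t0) (h ** U)) = 0"
        using A' by (simp add: admissible_def)
      fix U assume "U \<in> phase_group L \<sigma> M \<Omega> t0 \<Delta>t"
      then have "h ** U \<in> unitary_group"
        using h by (auto intro: mult_unitary phase_group_unitary)
      then show "\<bar>surface_layer L \<sigma>' M' A' \<sigma> M (\<Omega> t0) (h ** U)\<bar>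
                 \<le> 2 * (C * measure \<sigma> (space \<sigma>) * measure \<sigma>' (space \<sigma>'))"
        using A' P' C by (intro abs_surface_layer_le fin \<open>0 \<le> C\<close> \<Omega>) auto
    qed
    then show "0 \<le> ereal (ln (set_average \<mu>G (phase_group L \<sigma> M \<Omega> t0 \<Delta>t)
                   (\<lambda>U. exp (\<beta> * surface_layer L \<sigma>' M' A' \<sigma> M (\<Omega> t0) (h ** U)))))"
      by simp
  qed
qed

context layer_space
begin

lemma admissible_mat_1:
  assumes \<mu>: "normalized_haar \<mu>G" and A: "\<Omega> t0 \<in> sets \<sigma>" "\<Omega> t0 \<subseteq> M"
  shows "(\<Omega> t0, mat 1) \<in> admissible \<mu>G L \<sigma> M \<sigma> M \<Omega> t0 \<Delta>t"
proof -
  let ?S = "phase_group L \<sigma> M \<Omega> t0 \<Delta>t"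
  define g where "g = (\<lambda>U. indicator ?S U * \<gamma> (\<Omega> t0) (\<Omega> t0) U)"
  have "integral\<^sup>L \<mu>G g = 0"
  \<comment> \<open>If \<open>g\<close> is not integrable, its integral is 0 by convention, which
    also is the admissibility condition.\<close>
  proof (cases "integrable \<mu>G g")
    case True
    have "integral\<^sup>L \<mu>G g = (LINT U|\<mu>G. g (adj U))"
      using haar_integral_adj[OF \<mu> True] by simp
    also have "\<dots> = (LINT U|\<mu>G. - g U)"
    proof (rule Bochner_Integration.integral_cong[OF refl])
      fix U assume "U \<in> space \<mu>G"
      then have U: "U \<in> unitary_group" by (simp add: normalized_haar_space[OF \<mu>])
      show "g (adj U) = - g U"
        using phase_group_adj_iff[OF U, of L \<sigma> M \<Omega> t0 \<Delta>t] surface_layer_adj[OF A U]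
        by (auto simp: g_def indicator_def)
    qed
    finally show ?thesis by simp
  qed (simp add: not_integrable_integral_eq)
  then show ?thesis
    by (simp add: admissible_def set_average_def set_lebesgue_integral_def g_def)
qed

text \<open>The premise \<open>small\<close> is continuity in \<open>t\<close> at \<open>t0\<close>,
  uniformly over the group; uniformity matters because the time at which the layer integral vanishes
  depends on \<open>U\<close>.\<close>

lemma entropy_le_0:
  assumes \<mu>: "normalized_haar \<mu>G" and A: "\<Omega> t0 \<in> sets \<sigma>" "\<Omega> t0 \<subseteq> M" "\<Omega> t0 \<in> P"
    and small: "\<And>\<epsilon>. \<epsilon> > 0 \<Longrightarrow> eventually (\<lambda>\<Delta>t. \<forall>t\<in>{t0 - \<Delta>t<..<t0 + \<Delta>t}. \<forall>V\<in>unitary_group.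
        \<bar>\<gamma> (\<Omega> t0) (\<Omega> t) V - \<gamma> (\<Omega> t0) (\<Omega> t0) V\<bar> \<le> \<epsilon>) (at_right 0)"
  shows "entropy \<beta> \<mu>G L \<sigma> M P \<sigma> M \<Omega> t0 (\<Omega> t0) \<le> 0"
proof (rule ereal_le_epsilon2)
  fix e :: real assume "e > 0"
  have fin: "finite_measure \<mu>G"
    by standard (simp add: normalized_haar_prob[OF \<mu>])
  \<comment> \<open>Adding 1 to the denominator covers \<open>\<beta> = 0\<close>.\<close>
  define \<epsilon> where "\<epsilon> = e / (\<bar>\<beta>\<bar> + 1)"
  have \<epsilon>: "\<epsilon> > 0" "\<bar>\<beta>\<bar> * \<epsilon> \<le> e"
    using \<open>e > 0\<close> by (auto simp: \<epsilon>_def field_simps)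
  let ?f = "\<lambda>\<Delta>t. INF h\<in>{h \<in> unitary_group. (\<Omega> t0, h) \<in> admissible \<mu>G L \<sigma> M \<sigma> M \<Omega> t0 \<Delta>t}.
         entropy_at \<beta> \<mu>G L \<sigma> M P \<sigma> M \<Omega> t0 \<Delta>t h"
  have "eventually (\<lambda>\<Delta>t. ?f \<Delta>t \<le> ereal e) (at_right 0)"
    using small[OF \<epsilon>(1)]
  proof eventually_elim
    case (elim \<Delta>t)
    let ?S = "phase_group L \<sigma> M \<Omega> t0 \<Delta>t"
    \<comment> \<open>The zero may belong to \<open>adj U\<close> instead of \<open>U\<close>; by
      \<open>surface_layer_adj\<close> both have the same modulus at equal pasts.\<close>
    have \<gamma>_le: "\<bar>\<gamma> (\<Omega> t0) (\<Omega> t0) U\<bar> \<le> \<epsilon>" if U: "U \<in> ?S" for U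
    proof -
      have G: "U \<in> unitary_group" using U by (rule phase_group_unitary)
      obtain t where t: "t \<in> {t0 - \<Delta>t<..<t0 + \<Delta>t}"
        and "\<gamma> (\<Omega> t0) (\<Omega> t) U = 0 \<or> \<gamma> (\<Omega> t0) (\<Omega> t) (adj U) = 0"
        using U by (auto simp: phase_group_def matrix_inv_unitary)
      then show ?thesis
        using bspec[OF bspec[OF elim t] G] bspec[OF bspec[OF elim t] adj_unitary[OF G]]
          surface_layer_adj[OF A(1,2) G] by auto
    qed
    have adm: "(\<Omega> t0, mat 1) \<in> admissible \<mu>G L \<sigma> M \<sigma> M \<Omega> t0 \<Delta>t"
      by (rule admissible_mat_1[where \<Omega> = \<Omega> and ?t0.0 = t0, OF \<mu> A(1,2)])
    have "?f \<Delta>t \<le> entropy_at \<beta> \<mu>G L \<sigma> M P \<sigma> M \<Omega> t0 \<Delta>t (mat 1)"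
      using adm mat_1_unitary by (intro INF_lower) simp
    also have "\<dots> \<le> ereal (ln (set_average \<mu>G ?S (\<lambda>U. exp (\<beta> * \<gamma> (\<Omega> t0) (\<Omega> t0) (mat 1 ** U)))))"
      unfolding entropy_at_def using adm A(3) by (intro INF_lower) simp
    also have "\<dots> \<le> ereal e"
      using ln_set_average_exp_le[where \<beta> = \<beta>, OF fin \<gamma>_le] \<epsilon> by force
    finally show ?case .
  qed
  then have "Limsup (at_right 0) ?f \<le> ereal e"
    by (rule Limsup_bounded)
  moreover have "Liminf (at_right 0) ?f \<le> Limsup (at_right 0) ?f"
    by (rule Liminf_le_Limsup) (rule trivial_limit_at_right_real)
  ultimately show "entropy \<beta> \<mu>G L \<sigma> M P \<sigma> M \<Omega> t0 (\<Omega> t0) \<le> 0 + ereal e"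
    unfolding entropy_def by simp
qed

end

section \<open>Time slabs and the cutoff\<close>

text \<open>Extracts what the interval and the circle have in common. One of the two times must be
  interior for uniqueness, because the circle identifies the times 0 and \<open>T\<close>.\<close>

lemma product_parametrization:
  fixes M :: "'a::topological_space set" and N :: "'b::topological_space set"
  assumes "T > 0" "compact M"
    and prod: "interval_product T N \<Phi> M \<or> circle_product T N \<Phi> M"
  shows "compact N" "continuous_on ({0..T} \<times> N) \<Phi>" "\<Phi> ` ({0..T} \<times> N) \<subseteq> M"
    and "\<And>s p s' p'. s \<in> {0..T} \<Longrightarrow> s' \<in> {0<..<T} \<Longrightarrow> p \<in> N \<Longrightarrow> p' \<in> N \<Longrightarrow>
           \<Phi> (s, p) = \<Phi> (s', p') \<Longrightarrow> s = s'"
proof -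
  have "compact N \<and> continuous_on ({0..T} \<times> N) \<Phi> \<and> \<Phi> ` ({0..T} \<times> N) \<subseteq> M \<and>
    (\<forall>s\<in>{0..T}. \<forall>s'\<in>{0<..<T}. \<forall>p\<in>N. \<forall>p'\<in>N. \<Phi> (s, p) = \<Phi> (s', p') \<longrightarrow> s = s')"
    using prod
  proof
    assume "interval_product T N \<Phi> M"
    then obtain \<Theta> where h: "homeomorphism ({0..T} \<times> N) M \<Phi> \<Theta>"
      by (auto simp: interval_product_def)
    have "compact ({0..T} \<times> N)"
      using compact_continuous_image[OF homeomorphism_cont2[OF h] \<open>compact M\<close>]
        homeomorphism_image2[OF h] by simp
    then have "compact (snd ` ({0..T} \<times> N))"
      by (intro compact_continuous_image continuous_intros)
    moreover have "snd ` ({0..T} \<times> N) = N"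
    proof -
      have "p \<in> snd ` ({0..T} \<times> N)" if "p \<in> N" for p
        by (rule image_eqI[where x = "(0, p)"]) (use that \<open>T > 0\<close> in auto)
      then show ?thesis by auto
    qed
    moreover have "s = s'" if "s \<in> {0..T}" "s' \<in> {0<..<T}" "p \<in> N" "p' \<in> N" "\<Phi> (s, p) = \<Phi> (s', p')"
      for s s' p p'
    proof -
      have "(s, p) = \<Theta> (\<Phi> (s, p))" "(s', p') = \<Theta> (\<Phi> (s', p'))"
        using that(1-4) by (simp_all add: homeomorphism_apply1[OF h])
      then show ?thesis using that(5) by simp
    qed
    ultimately show ?thesis
      using homeomorphism_cont1[OF h] homeomorphism_image1[OF h] by (metis order_refl)
  next
    assume "circle_product T N \<Phi> M"
    then obtain \<Psi> \<Theta> where h: "homeomorphism (sphere (0::complex) 1 \<times> N) M \<Psi> \<Theta>"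
      and \<Phi>: "\<And>t p. t \<in> {0..T} \<Longrightarrow> p \<in> N \<Longrightarrow> \<Phi> (t, p) = \<Psi> (cis (2 * pi * t / T), p)"
      by (auto simp: circle_product_def)
    have "compact (sphere (0::complex) 1 \<times> N)"
      using compact_continuous_image[OF homeomorphism_cont2[OF h] \<open>compact M\<close>]
        homeomorphism_image2[OF h] by simp
    then have "compact (snd ` (sphere (0::complex) 1 \<times> N))"
      by (intro compact_continuous_image continuous_intros)
    moreover have "snd ` (sphere (0::complex) 1 \<times> N) = N"
    proof -
      have "p \<in> snd ` (sphere (0::complex) 1 \<times> N)" if "p \<in> N" for p
        by (rule image_eqI[where x = "(1, p)"]) (use that in auto)
      then show ?thesis by auto
    qed
    moreover have "continuous_on ({0..T} \<times> N) \<Phi>"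
    proof -
      have "continuous_on ({0..T} \<times> N) (\<lambda>x. \<Psi> (cis (2 * pi * fst x / T), snd x))"
        by (rule continuous_on_compose2[OF homeomorphism_cont1[OF h]])
           (use \<open>T > 0\<close> in \<open>auto intro!: continuous_intros\<close>)
      then show ?thesis
        by (rule continuous_on_eq) (auto simp: \<Phi>)
    qed
    moreover have "\<Phi> ` ({0..T} \<times> N) \<subseteq> M"
      using homeomorphism_image1[OF h] by (auto simp: \<Phi>)
    moreover have "s = s'" if s: "s \<in> {0..T}" "s' \<in> {0<..<T}" and p: "p \<in> N" "p' \<in> N"
      and eq: "\<Phi> (s, p) = \<Phi> (s', p')" for s s' p p'
    proof -
      have "cis (2 * pi * s / T) = cis (2 * pi * s' / T)"
      proof -
        have "(cis (2 * pi * s / T), p) = \<Theta> (\<Phi> (s, p))"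
          "(cis (2 * pi * s' / T), p') = \<Theta> (\<Phi> (s', p'))"
          using s p by (simp_all add: \<Phi> homeomorphism_apply1[OF h])
        then show ?thesis using eq by (metis prod.inject)
      qed
      then have "sin (2 * pi * s / T) = sin (2 * pi * s' / T) \<and> cos (2 * pi * s / T) = cos (2 * pi * s' / T)"
        by (metis cis.sel)
      then obtain k :: int where "2 * pi * s / T = 2 * pi * s' / T + 2 * pi * k"
        unfolding sin_cos_eq_iff by (rule exE)
      then have "(2 * pi) * s = (2 * pi) * (s' + T * k)"
        using \<open>T > 0\<close> by (simp add: field_simps)
      then have k: "s = s' + T * k"
        by (subst (asm) mult_left_cancel) auto
      \<comment> \<open>Strict since \<open>s'\<close> is interior; this excludes a full turn around
        the circle.\<close>
      have "\<bar>s - s'\<bar> < T" using s by auto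
      then have "T * \<bar>real_of_int k\<bar> < T * 1"
        using \<open>T > 0\<close> by (simp add: k abs_mult)
      then have "\<bar>real_of_int k\<bar> < 1"
        using \<open>T > 0\<close> by (subst (asm) mult_less_cancel_left_pos) auto
      then have "k = 0" by linarith
      then show "s = s'" using k by simp
    qed
    ultimately show ?thesis by metis
  qed
  then show "compact N" "continuous_on ({0..T} \<times> N) \<Phi>" "\<Phi> ` ({0..T} \<times> N) \<subseteq> M"
    and "\<And>s p s' p'. s \<in> {0..T} \<Longrightarrow> s' \<in> {0<..<T} \<Longrightarrow> p \<in> N \<Longrightarrow> p' \<in> N \<Longrightarrow>
           \<Phi> (s, p) = \<Phi> (s', p') \<Longrightarrow> s = s'"
    by blast+
qed

lemma past_mono: "s \<le> t \<Longrightarrow> past N \<Phi> s \<subseteq> past N \<Phi> t"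
  unfolding past_def by (intro image_mono) auto

lemma past_compact:
  assumes "compact N" "continuous_on ({0..T} \<times> N) \<Phi>" "t \<le> T"
  shows "compact (past N \<Phi> t)"
  unfolding past_def using assms
  by (intro compact_continuous_image compact_Times) (auto elim!: continuous_on_subset)

text \<open>The slabs decrease to a set whose points all have time \<open>t0\<close>. The fibre
  there may carry mass for \<open>\<mu> t0\<close>, but a single time is null for \<open>dt\<close>;
  continuity from above in the finite measure does the rest.\<close>

lemma time_slab_small:
  fixes \<rho> :: "'a::topological_space measure" and N :: "'b::topological_space set"
  assumes dis: "time_disintegration T N \<Phi> \<rho> \<mu>" and fin: "finite_measure \<rho>"
    and t0: "t0 \<in> {0<..<T}"
    and inj: "\<And>s p s' p'. s \<in> {0..T} \<Longrightarrow> s' \<in> {0<..<T} \<Longrightarrow> p \<in> N \<Longrightarrow> p' \<in> N \<Longrightarrow>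
           \<Phi> (s, p) = \<Phi> (s', p') \<Longrightarrow> s = s'"
    and sets: "\<And>t. t \<in> {0..T} \<Longrightarrow> past N \<Phi> t \<in> sets \<rho>"
    and "e > 0"
  obtains r where "r > 0" "{t0 - r..t0 + r} \<subseteq> {0<..<T}"
    "measure \<rho> (past N \<Phi> (t0 + r) - past N \<Phi> (t0 - r)) \<le> e"
proof -
  interpret finite_measure \<rho> by fact
  \<comment> \<open>Half the distance to the end times keeps all slabs in the interior, where the
    time of a point is unique.\<close>
  define c where "c = min t0 (T - t0) / 2"
  define r where "r m = c / real (Suc m)" for m
  define D where "D m = past N \<Phi> (t0 + r m) - past N \<Phi> (t0 - r m)" for m
  have c: "c > 0" using t0 by (auto simp: c_def)
  have r: "r m > 0" "r m \<le> c" for m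
    using c by (auto simp: r_def field_simps)
  have inside: "t0 - r m > 0" "t0 + r m < T" for m
    using r(2)[of m] t0 by (auto simp: c_def min_def split: if_splits)
  have r_lim: "r \<longlonglongrightarrow> 0"
    unfolding r_def by real_asymp
  have D_sets: "D m \<in> sets \<rho>" for m
    unfolding D_def using inside[of m] r(1)[of m] by (intro sets.Diff sets) auto
  have "decseq D"
  proof (rule decseq_SucI)
    fix m
    have "r (Suc m) \<le> r m" using c by (simp add: r_def frac_le)
    then show "D (Suc m) \<subseteq> D m"
      unfolding D_def by (intro Diff_mono past_mono) auto
  qed
  then have lim: "(\<lambda>m. emeasure \<rho> (D m)) \<longlonglongrightarrow> emeasure \<rho> (\<Inter>m. D m)"
    using D_sets by (intro Lim_emeasure_decseq) (auto simp: emeasure_finite)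
  \<comment> \<open>\<open>D m\<close> is an image under \<open>\<Phi>\<close>, so its points are
    known only through some parameter \<open>s'\<close>; \<open>inj\<close> carries the estimate for
    \<open>s'\<close> over to \<open>s\<close>.\<close>
  have near: "\<bar>s - t0\<bar> \<le> r m" if s: "s \<in> {0..T}" "p \<in> N" "\<Phi> (s, p) \<in> D m" for s p m
  proof -
    obtain s' p' where s': "s' \<in> {0..t0 + r m}" "p' \<in> N" "\<Phi> (s, p) = \<Phi> (s', p')"
      using s(3) by (auto simp: D_def past_def)
    have "s' > t0 - r m"
      using s(3) s' by (force simp: D_def past_def)
    then have "s = s'"
      using inside[of m] s' s by (intro inj) auto
    then show ?thesis using s'(1) \<open>s' > t0 - r m\<close> by auto
  qed
  define Z where "Z t = {p \<in> N. \<Phi> (t, p) \<in> (\<Inter>m. D m)}" for t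
  have "(\<Inter>m. D m) \<in> sets \<rho>" using D_sets by auto
  then have "emeasure \<rho> (\<Inter>m. D m)
      = (\<integral>\<^sup>+t. emeasure (\<mu> t) (Z t) \<partial>lebesgue_on {0..T})"
    using dis unfolding time_disintegration_def Z_def by blast
  also have "\<dots> = (\<integral>\<^sup>+t. emeasure (\<mu> t) (Z t) * indicator {0..T} t \<partial>lebesgue)"
    by (subst nn_integral_restrict_space) auto
  also have "\<dots> = (\<integral>\<^sup>+t. 0 \<partial>(lebesgue :: real measure))"
  proof (rule nn_integral_cong_AE)
    have "AE t in lebesgue. t \<notin> {t0}"
      by (rule AE_not_in) simp
    then show "AE t in lebesgue.
        emeasure (\<mu> t) (Z t) * indicator {0..T} t = 0"
    proof eventually_elim
      case (elim t)
      have "Z t = {}" if "t \<in> {0..T}"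
      proof (rule ccontr)
        assume "Z t \<noteq> {}"
        then obtain p where "p \<in> N" "\<And>m. \<Phi> (t, p) \<in> D m" by (auto simp: Z_def)
        then have "\<And>m. \<bar>t - t0\<bar> \<le> r m" using near that by auto
        then have "\<bar>t - t0\<bar> \<le> 0"
          using LIMSEQ_le_const[OF r_lim] by blast
        then show False using elim by simp
      qed
      then show ?case by (cases "t \<in> {0..T}") simp_all
    qed
  qed
  finally have "emeasure \<rho> (\<Inter>m. D m) = 0" by simp
  then have "eventually (\<lambda>m. emeasure \<rho> (D m) < ennreal e) sequentially"
    using lim \<open>e > 0\<close> by (intro order_tendstoD(2)[of _ 0]) auto
  then obtain m where "emeasure \<rho> (D m) < ennreal e"
    using eventually_sequentially by auto
  then have "measure \<rho> (D m) \<le> e"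
    using \<open>e > 0\<close> by (simp add: emeasure_eq_measure ennreal_less_iff)
  moreover have "{t0 - r m..t0 + r m} \<subseteq> {0<..<T}"
    using inside[of m] by auto
  ultimately show ?thesis
    using that[of "r m"] r(1)[of m] by (simp add: D_def)
qed

lemma
  assumes "cutoff_function T t0 \<delta> \<eta>"
  shows sets_cutoff_measure: "sets (cutoff_measure T N \<Phi> \<eta> \<rho>) = sets \<rho>"
    and emeasure_cutoff_measure_le: "emeasure (cutoff_measure T N \<Phi> \<eta> \<rho>) A \<le> emeasure \<rho> A"
proof -
  let ?f = "\<lambda>x. ennreal (spacetime_cutoff T N \<Phi> \<eta> x)"
  show sets: "sets (cutoff_measure T N \<Phi> \<eta> \<rho>) = sets \<rho>"
    by (simp add: cutoff_measure_def)
  have "spacetime_cutoff T N \<Phi> \<eta> x \<le> 1" for x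
  proof (cases "x \<in> \<Phi> ` ({0<..<T} \<times> N)")
    case True
    then have "inv_into ({0<..<T} \<times> N) \<Phi> x \<in> {0<..<T} \<times> N"
      by (rule inv_into_into)
    then have "fst (inv_into ({0<..<T} \<times> N) \<Phi> x) \<in> {0<..<T}"
      by (auto simp: mem_Times_iff)
    then show ?thesis
      using assms True unfolding cutoff_function_def spacetime_cutoff_def by auto
  qed (simp add: spacetime_cutoff_def)
  then have f_le: "?f x \<le> 1" for x by simp
  show "emeasure (cutoff_measure T N \<Phi> \<eta> \<rho>) A \<le> emeasure \<rho> A"
  proof (cases "A \<in> sets \<rho>")
    case True
    \<comment> \<open>Unfolded to the raw \<open>measure_of\<close>, the left side is either the
      integral or the default 0, and the upper bound holds in both cases.\<close>
    have "emeasure (cutoff_measure T N \<Phi> \<eta> \<rho>) A \<le> (\<integral>\<^sup>+x. ?f x * indicator A x \<partial>\<rho>)"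
      unfolding cutoff_measure_def density_def emeasure_measure_of_conv by simp
    also have "\<dots> \<le> (\<integral>\<^sup>+x. indicator A x \<partial>\<rho>)"
      using f_le by (intro nn_integral_mono) (auto simp: indicator_def)
    finally show ?thesis using True by simp
  next
    case False
    then show ?thesis
      using sets by (simp add: emeasure_notin_sets)
  qed
qed

theorem theorem3p4:
  fixes n :: nat and \<kappa> \<beta> T t0 \<delta> :: real
    and \<rho> \<rho>' \<mu>G :: "'f::finite opr measure"
    and M M' :: "'f opr set"
    and P P' :: "'f opr set set"
    and N :: "'b::topological_space set"
    and \<Phi> :: "real \<times> 'b \<Rightarrow> 'f opr"
    and \<mu> :: "real \<Rightarrow> 'b measure"
    and \<eta> :: "real \<Rightarrow> real"
  assumes "n \<ge> 1" and "\<kappa> > 0"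
    and "minimizer n \<kappa> \<rho>" and "minimizer n \<kappa> \<rho>'"
    and "M = msupport \<rho>" and "M' = msupport \<rho>'"
    and "compact M" and "compact M'"
    and "normalized_haar \<mu>G"
    and "interval_product T N \<Phi> M \<or> circle_product T N \<Phi> M"
    and "time_disintegration T N \<Phi> \<rho> \<mu>"
    and "t0 \<in> {0<..<T}" and "\<delta> > 0" and "{t0 - \<delta><..<t0 + \<delta>} \<subseteq> {0<..<T}"
    and "cutoff_function T t0 \<delta> \<eta>"
    and "P' \<subseteq> {A. A \<subseteq> M' \<and> A \<in> sets borel}"
    and "P \<subseteq> {A. A \<subseteq> M \<and> A \<in> sets borel}" and "past N \<Phi> t0 \<in> P"
  shows "(\<forall>A\<in>P'. entropy \<beta> \<mu>G (lagrangian n \<kappa>) \<rho>' M' P'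
                   (cutoff_measure T N \<Phi> \<eta> \<rho>) M (past N \<Phi>) t0 A \<ge> 0)
       \<and> entropy \<beta> \<mu>G (lagrangian n \<kappa>) (cutoff_measure T N \<Phi> \<eta> \<rho>) M P
           (cutoff_measure T N \<Phi> \<eta> \<rho>) M (past N \<Phi>) t0 (past N \<Phi> t0) = 0"
proof -
  define \<sigma> where "\<sigma> = cutoff_measure T N \<Phi> \<eta> \<rho>"
  define F :: "'f opr set" where "F = spacetime_ops n"
  note \<mu> = \<open>normalized_haar \<mu>G\<close>
  have fin_\<mu>: "finite_measure \<mu>G"
    by standard (simp add: normalized_haar_prob[OF \<mu>])
  have fin_\<rho>: "finite_measure \<rho>" "finite_measure \<rho>'" and sets_\<rho>: "sets \<rho> = sets (restrict_space borel F)"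
    using assms(3,4) by (auto simp: minimizer_def regular_borel_on_def F_def)
  have sets_cut: "sets \<sigma> = sets \<rho>" and \<sigma>_le: "emeasure \<sigma> A \<le> emeasure \<rho> A" for A
    unfolding \<sigma>_def
    by (rule sets_cutoff_measure[OF assms(15)], rule emeasure_cutoff_measure_le[OF assms(15)])
  have \<rho>_less: "emeasure \<rho> A < top" for A
    using finite_measure.emeasure_finite[OF fin_\<rho>(1), of A]
    unfolding infinity_ennreal_def top.not_eq_extremum .
  have fin_\<sigma>: "finite_measure \<sigma>"
  proof
    show "emeasure \<sigma> (space \<sigma>) \<noteq> \<infinity>"
      using le_less_trans[OF \<sigma>_le[of "space \<sigma>"] \<rho>_less] by simp
  qed
  have measure_le: "measure \<sigma> A \<le> measure \<rho> A" for A
    unfolding measure_def by (rule enn2real_mono[OF \<sigma>_le \<rho>_less])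
  have "space \<rho> = F"
    using sets_eq_imp_space_eq[OF sets_\<rho>] by (simp add: space_restrict_space)
  then have "M \<subseteq> F" using assms(5) by (auto simp: msupport_def)
  \<comment> \<open>\<open>\<rho>\<close> lives on the trace of the Borel sets on \<open>F\<close>;
    a compact subset of \<open>M\<close> is its own trace.\<close>
  have compact_sets: "K \<in> sets \<rho>" if "compact K" "K \<subseteq> M" for K
  proof -
    have "K \<in> sets borel" using that(1) by (intro borel_closed compact_imp_closed)
    moreover have "K = F \<inter> K" using that(2) \<open>M \<subseteq> F\<close> by blast
    ultimately show ?thesis unfolding sets_\<rho> sets_restrict_space by (rule image_eqI[rotated])
  qed
  have "T > 0" using assms(12) by auto
  note param = product_parametrization[OF \<open>T > 0\<close> assms(7,10)]
  have past_M: "past N \<Phi> t \<subseteq> M" if "t \<le> T" for t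
    using param(3) that by (auto simp: past_def image_subset_iff)
  have past_sets: "past N \<Phi> t \<in> sets \<rho>" if "t \<in> {0..T}" for t
    using that by (intro compact_sets past_compact[OF param(1,2)] past_M) auto
  have t0: "t0 \<in> {0..T}" using assms(12) by auto

  \<comment> \<open>\<open>C\<close> controls pairs from \<open>M'\<close> and \<open>M\<close> in
    the interacting case, \<open>D\<close> below controls pairs from \<open>M\<close> in the
    vacuum.\<close>
  obtain C where C0: "C \<ge> 0" and "\<forall>x\<in>M'. \<forall>y\<in>M. \<forall>V\<in>unitary_group.
      \<bar>lagrangian n \<kappa> x (V ** y ** matrix_inv V)\<bar> \<le> C"
    using lagrangian_conj_bounded[OF assms(7,8), of n \<kappa>] by (elim exE conjE)
  note C = C0 bspec[OF bspec[OF bspec[OF this(2)]]]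
  obtain D where D0: "D \<ge> 0" and "\<forall>x\<in>M. \<forall>y\<in>M. \<forall>V\<in>unitary_group.
      \<bar>lagrangian n \<kappa> x (V ** y ** matrix_inv V)\<bar> \<le> D"
    using lagrangian_conj_bounded[OF assms(7,7), of n \<kappa>] by (elim exE conjE)
  note D = D0 bspec[OF bspec[OF bspec[OF this(2)]]]

  interpret layer_space "lagrangian n \<kappa>" \<sigma> F M D
  proof (rule layer_space.intro)
    show "(\<lambda>p :: 'f opr \<times> 'f opr. lagrangian n \<kappa> (fst p) (snd p)) \<in> borel_measurable borel"
      by (rule borel_measurable_lagrangian)
    show "sets \<sigma> = sets (restrict_space borel F)" using sets_cut sets_\<rho> by simp
    show "M \<in> sets \<sigma>" unfolding sets_cut by (rule compact_sets[OF assms(7)]) simp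
  qed (rule fin_\<sigma> D lagrangian_swap_conj; assumption)+

  have "entropy \<beta> \<mu>G (lagrangian n \<kappa>) \<rho>' M' P' \<sigma> M (past N \<Phi>) t0 A \<ge> 0" for A

    by (rule entropy_nonneg[OF fin_\<mu> fin_\<sigma> fin_\<rho>(2) C0])
       (use assms(16) past_M t0 C(2) in auto)
  moreover have "entropy \<beta> \<mu>G (lagrangian n \<kappa>) \<sigma> M P \<sigma> M (past N \<Phi>) t0 (past N \<Phi> t0) \<ge> 0"

    by (rule entropy_nonneg[OF fin_\<mu> fin_\<sigma> fin_\<sigma> D0])
       (use assms(17) past_M t0 D(2) in auto)
  moreover have "entropy \<beta> \<mu>G (lagrangian n \<kappa>) \<sigma> M P \<sigma> M (past N \<Phi>) t0 (past N \<Phi> t0) \<le> 0"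
  proof (rule entropy_le_0[OF \<mu>])
    show "past N \<Phi> t0 \<in> sets \<sigma>" "past N \<Phi> t0 \<subseteq> M" "past N \<Phi> t0 \<in> P"
      using past_sets past_M t0 assms(18) by (auto simp: sets_cut)
    fix \<epsilon> :: real assume "\<epsilon> > 0"
    \<comment> \<open>The summand 1 makes the divisor in \<open>\<epsilon> / m\<close>
      positive.\<close>
    define m where "m = D * measure \<sigma> M + 1"
    have "m > 0" using D(1) by (simp add: m_def add_nonneg_pos)
    obtain r where r: "r > 0" "{t0 - r..t0 + r} \<subseteq> {0<..<T}"
      "measure \<rho> (past N \<Phi> (t0 + r) - past N \<Phi> (t0 - r)) \<le> \<epsilon> / m"
      by (rule time_slab_small[OF assms(11) fin_\<rho>(1) assms(12) param(4) past_sets, where e = "\<epsilon> / m"])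
         (use \<open>\<epsilon> > 0\<close> \<open>m > 0\<close> in auto)
    have "t0 - r \<in> {0<..<T}" "t0 + r \<in> {0<..<T}" using r(1) by (auto intro!: subsetD[OF r(2)] simp del: greaterThanLessThan_iff)
    then have ends: "t0 - r \<in> {0..T}" "t0 + r \<in> {0..T}" by auto
    let ?S = "past N \<Phi> (t0 + r) - past N \<Phi> (t0 - r)"
    \<comment> \<open>For such \<open>\<Delta>t\<close>, all pasts in question differ from the past
      of \<open>t0\<close> only inside the fixed slab \<open>?S\<close>.\<close>
    have "eventually (\<lambda>\<Delta>t. \<Delta>t < r) (at_right 0)"
      unfolding eventually_at_right_field using r(1) by auto
    then show "eventually (\<lambda>\<Delta>t. \<forall>t\<in>{t0 - \<Delta>t<..<t0 + \<Delta>t}. \<forall>V\<in>unitary_group.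
        \<bar>\<gamma> (past N \<Phi> t0) (past N \<Phi> t) V - \<gamma> (past N \<Phi> t0) (past N \<Phi> t0) V\<bar> \<le> \<epsilon>) (at_right 0)"
    proof eventually_elim
      case (elim \<Delta>t)
      show ?case
      proof (intro ballI)
        fix t V assume t: "t \<in> {t0 - \<Delta>t<..<t0 + \<Delta>t}" and V: "V \<in> (unitary_group :: 'f opr set)"
        have tr: "t0 - r \<le> t" "t \<le> t0 + r" using t elim by auto
        have tT: "t \<in> {0..T}" using tr ends by auto
        have "\<bar>\<gamma> (past N \<Phi> t0) (past N \<Phi> t) V - \<gamma> (past N \<Phi> t0) (past N \<Phi> t0) V\<bar>
              \<le> D * measure \<sigma> M * measure \<sigma> ?S"
        proof (rule surface_layer_diff_le)
          show "?S \<in> sets \<sigma>" "past N \<Phi> t0 \<in> sets \<sigma>" "past N \<Phi> t \<in> sets \<sigma>"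
            using past_sets ends t0 tT by (auto simp: sets_cut)
          show "past N \<Phi> t - past N \<Phi> t0 \<subseteq> ?S" "past N \<Phi> t0 - past N \<Phi> t \<subseteq> ?S"
            using tr r(1) by (intro Diff_mono past_mono; simp)+
          show "?S \<subseteq> M" "past N \<Phi> t0 \<subseteq> M" "past N \<Phi> t \<subseteq> M"
            using past_M[of "t0 + r"] past_M[of t0] past_M[of t] ends t0 tT by auto
        qed (use V past_sets past_M t0 in \<open>auto simp: sets_cut\<close>)
        \<comment> \<open>The slab is small for \<open>\<rho>\<close>; \<open>measure_le\<close>
          transfers this to the cutoff measure.\<close>
        also have "\<dots> \<le> m * (\<epsilon> / m)"
          using measure_le[of ?S] r(3) D(1) \<open>m > 0\<close>
          by (intro mult_mono) (auto simp: m_def)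
        also have "\<dots> = \<epsilon>" using \<open>m > 0\<close> by simp
        finally show "\<bar>\<gamma> (past N \<Phi> t0) (past N \<Phi> t) V - \<gamma> (past N \<Phi> t0) (past N \<Phi> t0) V\<bar> \<le> \<epsilon>" .
      qed
    qed
  qed
  ultimately show ?thesis
    unfolding \<sigma>_def by (auto intro: order.antisym)
qed

end
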